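(* For any $\beta>0$, $0\le\gamma\le\beta$ and $N>2$ let $$U^{\circ}_{\beta,\gamma}(\bar y)=\sum_{j=1}^{N}\frac{\beta}{y_j-y_{j-1}}+\sum_{j=2}^{N}\frac{\gamma}{y_j-y_{j-2}}+\frac{\gamma}{1-y_{N-1}+y_1},\qquad \bar y\in\mathcal S=\{(y_0,\ldots,y_N):0=y_0<\ldots<y_N=1\},$$ and let $\bar Y^{\circ}=(Y^\circ_0,\ldots,Y^\circ_N)$ be a random vector on $\mathcal S$ with Gibbs density $$f_{\bar Y^{\circ}}(\bar y)=\frac{1}{Z^{\circ}(N)}e^{-U^{\circ}_{\beta,\gamma}(\bar y)},\qquad \bar y\in\mathcal S,$$ where $Z^{\circ}(N)$ is the normalizing constant (partition function). Denote $$\delta=\delta(\gamma)=\frac{\gamma}{4\beta+\gamma+2\sqrt{4\beta^2+2\beta\gamma}}.$$ Then $\bar Y^\circ$ is evenly spaced in average, i.e. $$\mathbb E\left(Y^{\circ}_{k+1}-Y^{\circ}_k\right)=\frac1N ,$$ and $\bar Y^{\circ}$ has the following covariance structure: for all $j\le k$ $$\mathbf{Cov}\left(Y^{\circ}_{j+1}-Y^{\circ}_j,\;Y^{\circ}_{k+1}-Y^{\circ}_k\right)=\frac{1}{N^3}\,\frac{1}{2\beta+\gamma(1-\delta)/2}\left((-\delta)^{(k-j)_{N/2}}+O\left(N^{-1/6}\right)\right),$$ where $(k-j)_{N/2}=\min\{k-j,\;N-(k-j)\}$. In particular, $$\mathbf{Var}\left(Y^{\circ}_{j+1}-Y^{\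circ}_j\right)=\frac{1}{N^3}\,\frac{1}{2\beta+\gamma(1-\delta)/2}\left(1+O\left(N^{-1/6}\right)\right).$$
   Context: The density on $\mathcal S$ is with respect to Lebesgue measure $dy_1\cdots dy_{N-1}$ in the free coordinates $0<y_1<\ldots<y_{N-1}<1$. Indices $j,k$ range over $\{0,\ldots,N-1\}$. The $O(\cdot)$ terms refer to $N\to\infty$ with $\beta,\gamma$ fixed, uniformly over the indices $j\le k$. The convention $0^0=1$ is used when $\delta=0$. *)

theory Defs
  imports "HOL-Probability.Probability"
begin

(* A vector (y_0, ..., y_N) is a function that is undefined outside {..N}, i.e. an element of
   the space of the product measure over {..N}. *)

definition configurations :: "nat \<Rightarrow> (nat \<Rightarrow> real) set" where
  "configurations N = {y \<in> extensional {..N}. y 0 = 0 \<and> y N = 1 \<and> (\<forall>i<N. y i < y (Suc i))}"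

definition embed :: "nat \<Rightarrow> (nat \<Rightarrow> real) \<Rightarrow> nat \<Rightarrow> real" where
  "embed N y = (\<lambda>i\<in>{..N}. if i = 0 then 0 else if i = N then 1 else y i)"

(* Lebesgue measure dy_1 ... dy_(N-1) in the free coordinates, carried by the affine space
   y_0 = 0, y_N = 1. *)
definition free_lebesgue :: "nat \<Rightarrow> (nat \<Rightarrow> real) measure" where
  "free_lebesgue N =
     distr (\<Pi>\<^sub>M i\<in>{1..<N}. lborel) (\<Pi>\<^sub>M i\<in>{..N}. borel) (embed N)"

lemma measurable_embed:
  "embed N \<in> (\<Pi>\<^sub>M i\<in>{1..<N}. lborel) \<rightarrow>\<^sub>M (\<Pi>\<^sub>M i\<in>{..N}. borel)"
  unfolding embed_def
proof (rule measurable_restrict)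
  fix i assume "i \<in> {..N}"
  then show "(\<lambda>y. if i = 0 then 0 else if i = N then 1 else y i)
      \<in> borel_measurable (\<Pi>\<^sub>M i\<in>{1..<N}. lborel :: real measure)"
    using measurable_component_singleton[of i "{1..<N}" "\<lambda>_. lborel :: real measure"]
    by (cases "i = 0"; cases "i = N") auto
qed

definition energy :: "real \<Rightarrow> real \<Rightarrow> nat \<Rightarrow> (nat \<Rightarrow> real) \<Rightarrow> real" where
  "energy \<beta> \<gamma> N y =
     (\<Sum>j=1..N. \<beta> / (y j - y (j - 1))) + (\<Sum>j=2..N. \<gamma> / (y j - y (j - 2)))
       + \<gamma> / (1 - y (N - 1) + y 1)"

definition partition_function :: "real \<Rightarrow> real \<Rightarrow> nat \<Rightarrow> real" where
  "partition_function \<beta> \<gamma> N =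
     (LINT y:configurations N|free_lebesgue N. exp (- energy \<beta> \<gamma> N y))"

definition gibbs_density :: "real \<Rightarrow> real \<Rightarrow> nat \<Rightarrow> (nat \<Rightarrow> real) \<Rightarrow> real" where
  "gibbs_density \<beta> \<gamma> N y =
     indicator (configurations N) y * (exp (- energy \<beta> \<gamma> N y) / partition_function \<beta> \<gamma> N)"

definition decay :: "real \<Rightarrow> real \<Rightarrow> real" where
  "decay \<beta> \<gamma> = \<gamma> / (4 * \<beta> + \<gamma> + 2 * sqrt (4 * \<beta>\<^sup>2 + 2 * \<beta> * \<gamma>))"

definition gap :: "(nat \<Rightarrow> 'a \<Rightarrow> nat \<Rightarrow> real) \<Rightarrow> nat \<Rightarrow> nat \<Rightarrow> 'a \<Rightarrow> real" where
  "gap Y N k \<omega> = Y N \<omega> (k + 1) - Y N \<omega> k"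

definition covariance :: "'a measure \<Rightarrow> ('a \<Rightarrow> real) \<Rightarrow> ('a \<Rightarrow> real) \<Rightarrow> real" where
  "covariance M X Y =
     (LINT \<omega>|M. (X \<omega> - (LINT \<omega>|M. X \<omega>)) * (Y \<omega> - (LINT \<omega>|M. Y \<omega>)))"

(* r N j k = O(g N) as N tends to infinity, uniformly over 0 \<le> j \<le> k < N *)
definition uniform_bigo :: "(nat \<Rightarrow> nat \<Rightarrow> nat \<Rightarrow> real) \<Rightarrow> (nat \<Rightarrow> real) \<Rightarrow> bool" where
  "uniform_bigo r g \<longleftrightarrow>
     (\<exists>C. \<forall>\<^sub>F N in sequentially. \<forall>k<N. \<forall>j\<le>k. \<bar>r N j k\<bar> \<le> C * \<bar>g N\<bar>)"

end

theory Submission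
  imports Defs
begin

text \<open>
  In the rescaled gaps \<open>t\<^sub>k = N (y\<^sub>k\<^sub>+\<^sub>1 - y\<^sub>k)\<close>, indexed cyclically, the energy is rotation
  invariant, which gives the means. Write \<open>w = t - 1\<close> and let \<open>D\<^sub>i\<close> be the partial derivative of the
  energy, normalised to vanish at \<open>t = 1\<close>. Integrating by parts in the coordinate \<open>y\<^sub>m\<close> shows that
  \<open>E (\<partial>\<^sub>i f - f D\<^sub>i)\<close> does not depend on \<open>i\<close>. For \<open>f = w\<^sub>k\<close> and \<open>v = (-\<delta>)\<^sup>i + (-\<delta>)\<^sup>N\<^sup>-\<^sup>i\<close>, the exact Green
  function on the cycle of the Hessian at \<open>t = 1\<close>, this expresses \<open>E (w\<^sub>0 w\<^sub>d)\<close> by the claimed main term plus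
  expectations \<open>E (w\<^sub>d \<rho>\<^sub>i)\<close> of second order Taylor remainders of the drift.

  The remainders are controlled by moment bounds that come from the same identity: \<open>f = w\<^sub>k\<close> bounds the
  mean of \<open>S = \<Sum> w\<^sub>k D\<^sub>k\<close>, the radial field \<open>f = w\<^sub>k \<Sum> w\<^sub>j\<^sup>2\<close> gives \<open>E (P S) = (N + 1) E P\<close> with
  \<open>P = \<Sum> w\<^sub>j\<^sup>2\<close>, and \<open>f = w\<^sub>k\<^sup>3\<close> then gives fourth moments of order \<open>N\<^sup>-\<^sup>2\<close>. The resulting error is
  \<open>O(N\<^sup>-\<^sup>1\<^sup>/\<^sup>2)\<close>.\<close>

section \<open>Preliminaries\<close>

text \<open>\<open>(1 + x) ^ p / fact p\<close> is a single term of the series of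
  \<open>exp (1 + x)\<close>. This is how the Gibbs weight beats any polynomial in the
  energy.\<close>

lemma power_exp_le: fixes x :: real assumes "0 \<le> x" shows "(1 + x) ^ p * exp (- x) \<le> exp 1 * fact p"
proof -
  have "(1 + x) ^ p / fact p \<le> exp (1 + x)"
    using sum_le_suminf[OF summable_exp_generic[of "1 + x"], of "{p}"] assms
    by (simp add: exp_def divide_inverse mult.commute)
  then have "(1 + x) ^ p \<le> exp 1 * exp x * fact p"
    by (simp add: exp_add divide_le_eq)
  then show ?thesis
    by (simp add: exp_minus field_simps)
qed

text \<open>For x >= 1/2 the quotient is at most 6. For smaller x one has 4 (x - 1)^2 >= 1, so the
  second term alone dominates. The proof clears x^2 and completes squares around 1/2.\<close>

lemma linear_over_square_le: fixes x :: real assumes "0 < x"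
  shows "(x + 1) / x\<^sup>2 \<le> 6 + 4 * ((x - 1)\<^sup>2 * (x + 1) / x\<^sup>2)"
proof -
  have "(x + 1) * (1 - 4 * (x - 1)\<^sup>2) \<le> 6 * x\<^sup>2"
  proof -
    have "6 * x\<^sup>2 - (x + 1) * (1 - 4 * (x - 1)\<^sup>2) = 4 * x ^ 3 + 2 * x\<^sup>2 - 5 * x + 3"
      by (simp add: power2_eq_square power3_eq_cube algebra_simps)
    moreover have "4 * x ^ 3 + 2 * x\<^sup>2 - 5 * x + 3 = 4 * x * (x - 1 / 2)\<^sup>2 + 6 * (x - 1 / 2)\<^sup>2 + 3 / 2"
      by (simp add: power2_eq_square power3_eq_cube algebra_simps)
    moreover have "0 \<le> 4 * x * (x - 1 / 2)\<^sup>2 + 6 * (x - 1 / 2)\<^sup>2 + 3 / 2"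
      using assms by simp
    ultimately show ?thesis by linarith
  qed
  then have "(x + 1) * (1 - 4 * (x - 1)\<^sup>2) / x\<^sup>2 \<le> 6"
    using assms by (simp add: divide_le_eq)
  moreover have "(x + 1) * (1 - 4 * (x - 1)\<^sup>2) / x\<^sup>2 = (x + 1) / x\<^sup>2 - 4 * ((x - 1)\<^sup>2 * (x + 1) / x\<^sup>2)"
    by (simp add: algebra_simps diff_divide_distrib)
  ultimately show ?thesis by simp
qed

section \<open>The decay rate and its characteristic equation\<close>

lemma decay_bounds:
  assumes "0 < \<beta>" "0 \<le> \<gamma>" "\<gamma> \<le> \<beta>"
  shows "0 \<le> decay \<beta> \<gamma>" "decay \<beta> \<gamma> \<le> 1 / 4"
proof -
  define r where "r = sqrt (4 * \<beta>\<^sup>2 + 2 * \<beta> * \<gamma>)"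
  have r: "0 \<le> r" using assms by (simp add: r_def)
  have X: "0 < 4 * \<beta> + \<gamma> + 2 * r" "4 * \<gamma> \<le> 4 * \<beta> + \<gamma> + 2 * r" using assms r by linarith+
  show "0 \<le> decay \<beta> \<gamma>" "decay \<beta> \<gamma> \<le> 1 / 4"
    unfolding decay_def r_def[symmetric] using X assms by (simp_all add: divide_le_eq)
qed

text \<open>This says that q = -\<delta> solves the characteristic equation of the linearised
  nearest-neighbour recurrence. Its other root is 1/q when q is nonzero; the form without a division
  also covers \<gamma> = 0.\<close>

lemma decay_char:
  assumes "0 < \<beta>" "0 \<le> \<gamma>"
  shows "\<gamma> / 4 * (1 + (decay \<beta> \<gamma>)\<^sup>2) = (2 * \<beta> + \<gamma> / 2) * decay \<beta> \<gamma>"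
proof -
  define r where "r = sqrt (4 * \<beta>\<^sup>2 + 2 * \<beta> * \<gamma>)"
  have r: "0 \<le> r" "r\<^sup>2 = 4 * \<beta>\<^sup>2 + 2 * \<beta> * \<gamma>" using assms by (auto simp: r_def)
  define X where "X = 4 * \<beta> + \<gamma> + 2 * r"
  have X: "0 < X" using assms r by (simp add: X_def)
  \<comment> \<open>\<open>X\<close>, the denominator of \<open>decay\<close>, is the larger root of
    x^2 - (8 \<beta> + 2 \<gamma>) x + \<gamma>^2.\<close>
  have "X\<^sup>2 + \<gamma>\<^sup>2 = (8 * \<beta> + 2 * \<gamma>) * X"
    using r(2) by (simp add: X_def power2_eq_square algebra_simps)
  then have "\<gamma> * (X\<^sup>2 + \<gamma>\<^sup>2) / (4 * X\<^sup>2) = \<gamma> * ((8 * \<beta> + 2 * \<gamma>) * X) / (4 * X\<^sup>2)" by simp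
  moreover have "\<gamma> / 4 * (1 + (\<gamma> / X)\<^sup>2) = \<gamma> * (X\<^sup>2 + \<gamma>\<^sup>2) / (4 * X\<^sup>2)"
    using X by (simp add: field_simps power2_eq_square)
  moreover have "(2 * \<beta> + \<gamma> / 2) * (\<gamma> / X) = \<gamma> * ((8 * \<beta> + 2 * \<gamma>) * X) / (4 * X\<^sup>2)"
    using X by (simp add: field_simps power2_eq_square)
  ultimately show ?thesis
    unfolding decay_def r_def[symmetric] X_def[symmetric] by metis
qed

section \<open>Cyclic shifts of sums and of Lebesgue measure\<close>

lemma sum_cyclic_shift:
  fixes f :: "nat \<Rightarrow> 'b::comm_monoid_add"
  assumes "0 < N"
  shows "(\<Sum>k<N. f (Suc k mod N)) = (\<Sum>k<N. f k)"
proof -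
  obtain n where n: "N = Suc n"
    using assms gr0_implies_Suc by blast
  have "(\<Sum>k<n. f (Suc k mod N)) = (\<Sum>k<n. f (Suc k))"
    by (rule sum.cong) (auto simp: n)
  moreover have "(\<Sum>k<N. f k) = f 0 + (\<Sum>k<n. f (Suc k))"
    unfolding n by (rule sum.lessThan_Suc_shift)
  ultimately show ?thesis
    by (simp add: n add.commute)
qed

text \<open>Shifts the gaps cyclically by one place.\<close>

definition turn :: "nat \<Rightarrow> (nat \<Rightarrow> real) \<Rightarrow> nat \<Rightarrow> real" where
  "turn N y = (\<lambda>i\<in>{1..<N}. if i = N - 1 then 1 - y 1 else y (Suc i) - y 1)"

text \<open>A product measure is determined by its values on boxes. The preimage of a box is a box
  with relabelled and translated sides, whose lengths are unchanged.\<close>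

lemma PiM_lborel_shift:
  fixes c :: real and a b :: nat
  shows "distr (\<Pi>\<^sub>M i\<in>{Suc a..<Suc b}. lborel) (\<Pi>\<^sub>M i\<in>{a..<b}. lborel)
           (\<lambda>z. \<lambda>i\<in>{a..<b}. z (Suc i) - c) = (\<Pi>\<^sub>M i\<in>{a..<b}. lborel)"
    (is "distr ?L ?K ?f = ?K")
proof (rule product_sigma_finite.PiM_eqI)
  have m: "?f \<in> ?L \<rightarrow>\<^sub>M ?K"
    by (intro measurable_restrict) (auto intro!: borel_measurable_diff measurable_component_singleton)
  fix A :: "nat \<Rightarrow> real set"
  assume A: "\<And>i. i \<in> {a..<b} \<Longrightarrow> A i \<in> sets lborel"
  have vim: "?f -` Pi\<^sub>E {a..<b} A \<inter> space ?L =
      Pi\<^sub>E {Suc a..<Suc b} (\<lambda>i. (\<lambda>x. x - c) -` A (i - 1))"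
  proof (intro set_eqI iffI)
    fix z assume z: "z \<in> ?f -` Pi\<^sub>E {a..<b} A \<inter> space ?L"
    then have "z \<in> extensional {Suc a..<Suc b}"
      by (simp add: space_PiM PiE_def)
    moreover have "z i - c \<in> A (i - 1)" if "i \<in> {Suc a..<Suc b}" for i
      using z that by (cases i) (auto simp: PiE_iff)
    ultimately show "z \<in> Pi\<^sub>E {Suc a..<Suc b} (\<lambda>i. (\<lambda>x. x - c) -` A (i - 1))"
      by (auto simp: PiE_iff)
  next
    fix z assume "z \<in> Pi\<^sub>E {Suc a..<Suc b} (\<lambda>i. (\<lambda>x. x - c) -` A (i - 1))"
    then show "z \<in> ?f -` Pi\<^sub>E {a..<b} A \<inter> space ?L"
      by (force simp: PiE_iff space_PiM)
  qed
  have sh: "(\<lambda>x. x - c) -` B \<in> sets borel" "emeasure lborel ((\<lambda>x. x - c) -` B) = emeasure lborel B"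
    if "B \<in> sets borel" for B
  proof -
    show "(\<lambda>x. x - c) -` B \<in> sets borel"
      using measurable_sets[OF _ that, of "\<lambda>x. x - c" borel] by simp
    have "emeasure lborel B = emeasure (distr lborel borel ((+) (- c))) B"
      by (simp add: lborel_distr_plus)
    also have "\<dots> = emeasure lborel ((+) (- c) -` B \<inter> space lborel)"
      using that by (intro emeasure_distr) auto
    also have "(+) (- c) -` B \<inter> space lborel = (\<lambda>x. x - c) -` B"
      by auto
    finally show "emeasure lborel ((\<lambda>x. x - c) -` B) = emeasure lborel B" by simp
  qed
  interpret L: product_sigma_finite "\<lambda>_::nat. lborel :: real measure"
    by standard
  have "emeasure (distr ?L ?K ?f) (Pi\<^sub>E {a..<b} A) =
      emeasure ?L (?f -` Pi\<^sub>E {a..<b} A \<inter> space ?L)"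
    using A by (intro emeasure_distr m sets_PiM_I_finite) auto
  also have "\<dots> = (\<Prod>i\<in>{Suc a..<Suc b}. emeasure lborel ((\<lambda>x. x - c) -` A (i - 1)))"
    unfolding vim
  proof (intro L.emeasure_PiM)
    fix i assume "i \<in> {Suc a..<Suc b}"
    then have "i - 1 \<in> {a..<b}" by auto
    from A[OF this] show "(\<lambda>x. x - c) -` A (i - 1) \<in> sets lborel"
      using sh(1)[of "A (i - 1)"] by simp
  qed simp
  also have "\<dots> = (\<Prod>i\<in>{a..<b}. emeasure lborel ((\<lambda>x. x - c) -` A i))"
    unfolding prod.shift_bounds_Suc_ivl by simp
  also have "\<dots> = (\<Prod>i\<in>{a..<b}. emeasure lborel (A i))"
    using A by (intro prod.cong) (auto intro!: sh(2))
  finally show "emeasure (distr ?L ?K ?f) (Pi\<^sub>E {a..<b} A) = (\<Prod>i\<in>{a..<b}. emeasure lborel (A i))" .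
qed (auto intro: product_sigma_finite.intro lborel.sigma_finite_measure_axioms)

lemma measurable_turn:
  assumes "2 < N"
  shows "turn N \<in> (\<Pi>\<^sub>M i\<in>{1..<N}. lborel) \<rightarrow>\<^sub>M (\<Pi>\<^sub>M i\<in>{1..<N}. lborel)"
  unfolding turn_def
proof (rule measurable_restrict)
  fix i assume i: "i \<in> {1..<N}"
  have c: "(\<lambda>y. y j) \<in> borel_measurable (\<Pi>\<^sub>M i\<in>{1..<N}. lborel :: real measure)"
    if "j \<in> {1..<N}" for j
    using measurable_component_singleton[OF that, of "\<lambda>_. lborel :: real measure"] by simp
  show "(\<lambda>y. if i = N - 1 then 1 - y 1 else y (Suc i) - y 1)
      \<in> (\<Pi>\<^sub>M i\<in>{1..<N}. lborel) \<rightarrow>\<^sub>M (lborel :: real measure)"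
    using i assms c[of 1] c[of "Suc i"] by (cases "i = N - 1") auto
qed

text \<open>Fix y_1 = u and apply Fubini. The remaining coordinates are translated by u and
  relabelled, which \<open>PiM_lborel_shift\<close> absorbs, and the new last coordinate is 1 - u.
  The reflection of u then preserves the outer integral.\<close>

lemma distr_turn:
  assumes N: "2 < N"
  shows "distr (\<Pi>\<^sub>M i\<in>{1..<N}. lborel) (\<Pi>\<^sub>M i\<in>{1..<N}. lborel) (turn N) =
    (\<Pi>\<^sub>M i\<in>{1..<N}. lborel)"
    (is "distr ?L _ _ = _")
proof (rule measure_eqI)
  interpret L: product_sigma_finite "\<lambda>_::nat. lborel :: real measure"
    by standard
  define n where "n = N - 1"
  have n: "N = Suc n" "1 < n" using N by (auto simp: n_def)
  have I1: "{1..<N} = insert 1 {Suc 1..<Suc n}" and I2: "{1..<N} = insert n {1..<n}"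
    using n by auto
  fix A assume "A \<in> sets (distr ?L ?L (turn N))"
  then have A: "A \<in> sets ?L" by simp
  define h :: "(nat \<Rightarrow> real) \<Rightarrow> ennreal" where "h = indicator A"
  have h [measurable]: "h \<in> borel_measurable ?L"
    using A by (simp add: h_def)
  note mr [measurable] = measurable_turn[OF N]
  let ?K = "\<Pi>\<^sub>M i\<in>{1..<n}. lborel :: real measure"
  let ?K' = "\<Pi>\<^sub>M i\<in>{Suc 1..<Suc n}. lborel :: real measure"
  have ins: "(\<lambda>z. z(n := u)) \<in> ?K \<rightarrow>\<^sub>M ?L" for u
    unfolding I2 by (rule measurable_fun_upd[where J = "{1..<n}"]) auto
  have "emeasure (distr ?L ?L (turn N)) A = (\<integral>\<^sup>+y. h y \<partial>distr ?L ?L (turn N))"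
    using A by (simp add: h_def)
  also have "\<dots> = (\<integral>\<^sup>+y. h (turn N y) \<partial>?L)"
    by (rule nn_integral_distr[OF mr]) (use h in simp)
  also have "\<dots> = (\<integral>\<^sup>+u. (\<integral>\<^sup>+z. h (turn N (z(1 := u))) \<partial>?K') \<partial>lborel)"
    using measurable_compose[OF mr h] unfolding I1
    by (intro L.product_nn_integral_insert_rev) auto
  also have "\<dots> = (\<integral>\<^sup>+u. (\<integral>\<^sup>+z. h (z(n := 1 - u)) \<partial>?K) \<partial>lborel)"
  proof (rule nn_integral_cong)
    fix u :: real
    let ?f = "\<lambda>z. \<lambda>i\<in>{1..<n}. z (Suc i) - u"
    have m: "?f \<in> ?K' \<rightarrow>\<^sub>M ?K"
      by (intro measurable_restrict)
        (auto intro!: borel_measurable_diff measurable_component_singleton)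
    have eq: "turn N (z(1 := u)) = (?f z)(n := 1 - u)" for z
      by (rule ext) (use n in \<open>auto simp: turn_def\<close>)
    have "(\<integral>\<^sup>+z. h (turn N (z(1 := u))) \<partial>?K') = (\<integral>\<^sup>+z. h (z(n := 1 - u)) \<partial>distr ?K' ?K ?f)"
      unfolding eq using m measurable_compose[OF ins h] by (subst nn_integral_distr) auto
    then show "(\<integral>\<^sup>+z. h (turn N (z(1 := u))) \<partial>?K') = (\<integral>\<^sup>+z. h (z(n := 1 - u)) \<partial>?K)"
      by (simp only: PiM_lborel_shift)
  qed
  also have "\<dots> = (\<integral>\<^sup>+u. (\<integral>\<^sup>+z. h (z(n := u)) \<partial>?K) \<partial>lborel)"
  proof -
    let ?g = "\<lambda>u. \<integral>\<^sup>+z. h (z(n := u)) \<partial>?K"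
    have "?g \<in> borel_measurable lborel"
    proof (rule sigma_finite_measure.borel_measurable_nn_integral)
      show "sigma_finite_measure ?K"
        by (rule L.sigma_finite) simp
      have "(\<lambda>p. (snd p)(n := fst p)) \<in> (lborel \<Otimes>\<^sub>M ?K) \<rightarrow>\<^sub>M ?L"
        unfolding I2 by (rule measurable_fun_upd[where J = "{1..<n}"]) auto
      from measurable_compose[OF this h]
      show "(\<lambda>(u, z). h (z(n := u))) \<in> borel_measurable (lborel \<Otimes>\<^sub>M ?K)"
        by (simp add: case_prod_beta')
    qed
    then show ?thesis
      using nn_integral_real_affine[of ?g "-1" 1] by simp
  qed
  also have "\<dots> = (\<integral>\<^sup>+y. h y \<partial>?L)"
    using h unfolding I2 by (intro L.product_nn_integral_insert_rev[symmetric]) auto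
  also have "\<dots> = emeasure ?L A"
    using A by (simp add: h_def)
  finally show "emeasure (distr ?L ?L (turn N)) A = emeasure ?L A" .
qed simp

section \<open>The cyclic gas of gaps\<close>

locale cyclic_gas =
  fixes N :: nat and \<beta> \<gamma> :: real
  assumes N: "2 < N" and beta: "0 < \<beta>" and gamma: "0 \<le> \<gamma>" "\<gamma> \<le> \<beta>"
begin

definition L :: "(nat \<Rightarrow> real) measure" where
  "L = (\<Pi>\<^sub>M i\<in>{1..<N}. lborel)"

definition nx :: "nat \<Rightarrow> nat" where "nx k = Suc k mod N"

text \<open>The scaling by N puts the equally spaced configuration at t = 1. Going through
  \<open>embed\<close> treats the first and last gap like the others.\<close>

definition t :: "nat \<Rightarrow> (nat \<Rightarrow> real) \<Rightarrow> real" where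
  "t k y = real N * (embed N y (Suc k) - embed N y k)"

definition s :: "nat \<Rightarrow> (nat \<Rightarrow> real) \<Rightarrow> real" where
  "s k y = t k y + t (nx k) y"

definition conf :: "(nat \<Rightarrow> real) set" where
  "conf = {y \<in> space L. \<forall>k<N. 0 < t k y}"

text \<open>The energy written in scaled gaps (see \<open>energy_embed\<close>). The pair term of k
  = N - 1 is the wrap-around interaction, so the sum is cyclic.\<close>

definition H :: "(nat \<Rightarrow> real) \<Rightarrow> real" where
  "H y = (\<Sum>k<N. \<beta> * real N / t k y + \<gamma> * real N / s k y)"

definition wt :: "(nat \<Rightarrow> real) \<Rightarrow> real" where
  "wt y = indicator conf y * exp (- H y)"

definition Z :: real where "Z = (LINT y|L. wt y)"

text \<open>Division by \<open>Z\<close> yields 0 when \<open>Z\<close> = 0, so linearity and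
  monotonicity can be proved before \<open>Z\<close> is known to be nonzero.\<close>

definition E :: "((nat \<Rightarrow> real) \<Rightarrow> real) \<Rightarrow> real" where
  "E f = (LINT y|L. wt y * f y) / Z"

text \<open>The factor \<open>exp (- H)\<close> makes such functions integrable in spite of the poles of \<open>1 / t k\<close> on the
  boundary of the simplex.\<close>

definition adm :: "((nat \<Rightarrow> real) \<Rightarrow> real) \<Rightarrow> bool" where
  "adm f \<longleftrightarrow> f \<in> borel_measurable L \<and> (\<exists>C p. \<forall>y\<in>conf. \<bar>f y\<bar> \<le> C * (1 + H y) ^ p)"

section \<open>Geometry and measurability of the simplex of gaps\<close>

lemma N_pos: "0 < N" using N by simp

lemma nx_less: "nx k < N"
  using N by (simp add: nx_def)

lemma nx_eq: "Suc k < N \<Longrightarrow> nx k = Suc k" "nx (N - 1) = 0"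
  using N by (auto simp: nx_def)

lemma sum_nx: "(\<Sum>k<N. f (nx k)) = (\<Sum>k<N. f k)" for f :: "nat \<Rightarrow> real"
  unfolding nx_def by (rule sum_cyclic_shift[OF N_pos])

lemma space_L: "space L = PiE {1..<N} (\<lambda>_. UNIV)"
  by (simp add: L_def space_PiM)

lemma embed_simps: "embed N y 0 = 0" "embed N y N = 1"
  "0 < k \<Longrightarrow> k < N \<Longrightarrow> embed N y k = y k"
  using N by (auto simp: embed_def)

lemma sum_t: "(\<Sum>k<N. t k y) = real N"
  unfolding t_def sum_distrib_left[symmetric]
  by (subst sum_lessThan_telescope) (simp add: embed_simps)

lemma measurable_coord: "(\<lambda>y. embed N y k) \<in> borel_measurable L" if "k \<le> N"
  unfolding L_def
  by (rule measurable_compose[OF measurable_embed]) (use that in simp)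

lemma measurable_t: "k < N \<Longrightarrow> t k \<in> borel_measurable L"
  unfolding t_def[abs_def]
  by (intro borel_measurable_times borel_measurable_diff measurable_coord) auto

lemma measurable_s: "k < N \<Longrightarrow> s k \<in> borel_measurable L"
  unfolding s_def[abs_def] by (intro borel_measurable_add measurable_t nx_less)

lemma measurable_H: "H \<in> borel_measurable L"
  unfolding H_def[abs_def]
  by (intro borel_measurable_sum borel_measurable_add borel_measurable_divide measurable_t
      measurable_s) auto

lemma conf_sets: "conf \<in> sets L"
proof -
  have "conf = (\<Inter>k\<in>{..<N}. {y \<in> space L. 0 < t k y})"
    using N by (auto simp: conf_def)
  also have "\<dots> \<in> sets L"
    using N measurable_t by (intro sets.finite_INT borel_measurable_less) auto
  finally show ?thesis .
qed

lemma measurable_wt: "wt \<in> borel_measurable L"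
  unfolding wt_def[abs_def] using conf_sets measurable_H
  by (intro borel_measurable_times borel_measurable_indicator) auto

lemma t_pos: "y \<in> conf \<Longrightarrow> k < N \<Longrightarrow> 0 < t k y"
  by (simp add: conf_def)

lemma s_pos: "y \<in> conf \<Longrightarrow> k < N \<Longrightarrow> 0 < s k y"
  using t_pos nx_less by (simp add: s_def add_pos_pos)

lemma t_le: "y \<in> conf \<Longrightarrow> k < N \<Longrightarrow> t k y \<le> N"
  using member_le_sum[of k "{..<N}" "\<lambda>k. t k y"] t_pos by (force simp: sum_t)

text \<open>Used in two ways: it bounds 1 / \<open>t k\<close> polynomially in \<open>H\<close>, and
  it makes the Gibbs weight vanish when a gap closes.\<close>

lemma H_ge: assumes "y \<in> conf" "k < N" shows "\<beta> * real N / t k y \<le> H y"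
proof -
  have nn: "0 \<le> \<beta> * real N / t j y + \<gamma> * real N / s j y" if "j < N" for j
    using t_pos[OF assms(1) that] s_pos[OF assms(1) that] beta gamma by simp
  have "\<beta> * real N / t k y \<le> \<beta> * real N / t k y + \<gamma> * real N / s k y"
    using s_pos[OF assms] gamma by simp
  also have "\<dots> \<le> H y"
    unfolding H_def
  proof (rule member_le_sum[of k "{..<N}"])
    show "0 \<le> \<beta> * real N / t j y + \<gamma> * real N / s j y" if "j \<in> {..<N} - {k}" for j
      using that by (intro nn) auto
  qed (use assms in auto)
  finally show ?thesis .
qed

lemma H_nonneg: "y \<in> conf \<Longrightarrow> 0 \<le> H y"
  using t_pos[OF _ N_pos] beta by (intro order_trans[OF _ H_ge[OF _ N_pos]]) (simp_all add: less_imp_le)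

lemma embed_between:
  assumes "y \<in> conf" shows "i \<le> j \<Longrightarrow> j \<le> N \<Longrightarrow> embed N y i \<le> embed N y j"
proof (induction j rule: dec_induct)
  case (step n)
  then have "0 < t n y" using assms by (simp add: t_pos)
  then have "embed N y n < embed N y (Suc n)"
    using N by (simp add: t_def zero_less_mult_iff)
  with step show ?case by simp
qed simp

lemma conf_bounds: assumes "y \<in> conf" "i \<in> {1..<N}" shows "0 \<le> y i" "y i \<le> 1"
  using embed_between[OF assms(1), of 0 i] embed_between[OF assms(1), of i N] assms(2)
  by (auto simp: embed_simps)

lemma emeasure_conf: "emeasure L conf < \<infinity>"
proof -
  interpret L: product_sigma_finite "\<lambda>_::nat. lborel :: real measure"
    by standard
  have sub: "conf \<subseteq> PiE {1..<N} (\<lambda>_. {0..1})"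
  proof
    fix y assume y: "y \<in> conf"
    then have "y \<in> extensional {1..<N}"
      by (simp add: conf_def space_L PiE_def)
    then show "y \<in> PiE {1..<N} (\<lambda>_. {0..1})"
      using conf_bounds[OF y] by (simp add: PiE_def)
  qed
  have "emeasure L conf \<le> emeasure L (PiE {1..<N} (\<lambda>_. {0..1}))"
    unfolding L_def by (intro emeasure_mono sub sets_PiM_I_finite) auto
  also have "\<dots> = (\<Prod>i\<in>{1..<N}. emeasure (lborel :: real measure) {0..1})"
    unfolding L_def by (intro L.emeasure_PiM) auto
  also have "\<dots> = 1"
    by simp
  finally show ?thesis
    using order_le_less_trans by fastforce
qed

lemma integrable_adm: assumes "adm f" shows "integrable L (\<lambda>y. wt y * f y)"
proof -
  obtain C p where C: "\<And>y. y \<in> conf \<Longrightarrow> \<bar>f y\<bar> \<le> C * (1 + H y) ^ p"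
    and [measurable]: "f \<in> borel_measurable L"
    using assms by (auto simp: adm_def)
  note [measurable] = measurable_H
  have "integrable L (\<lambda>y. indicator conf y *\<^sub>R (exp (- H y) * f y))"
  proof (rule integrableI_bounded_set_indicator[OF conf_sets])
    show "(\<lambda>y. exp (- H y) * f y) \<in> borel_measurable L" by measurable
    show "AE y in L. y \<in> conf \<longrightarrow> norm (exp (- H y) * f y) \<le> C * (exp 1 * fact p)"
    proof (rule AE_I2, rule impI)
      fix y assume y: "y \<in> conf"
      have "0 \<le> C * (1 + H y) ^ p"
        using C[OF y] by linarith
      moreover have "0 < (1 + H y) ^ p"
        using H_nonneg[OF y] by simp
      \<comment> \<open>The constant in \<open>adm\<close> carries no sign condition; its sign is
        read off at a point of \<open>conf\<close>.\<close>
      ultimately have C0: "0 \<le> C"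
        by (simp add: zero_le_mult_iff)
      have "norm (exp (- H y) * f y) \<le> exp (- H y) * (C * (1 + H y) ^ p)"
        using C[OF y] by (simp add: abs_mult)
      also have "\<dots> = C * ((1 + H y) ^ p * exp (- H y))" by simp
      also have "\<dots> \<le> C * (exp 1 * fact p)"
        using H_nonneg[OF y] C0 by (intro mult_left_mono power_exp_le)
      finally show "norm (exp (- H y) * f y) \<le> C * (exp 1 * fact p)" .
    qed
  qed (rule emeasure_conf)
  then show ?thesis
    by (simp add: wt_def mult.assoc)
qed

section \<open>The algebra of admissible functions\<close>

lemma adm_measurable: "adm f \<Longrightarrow> f \<in> borel_measurable L"
  by (simp add: adm_def)

lemma adm_boundI:
  assumes "f \<in> borel_measurable L" "\<And>y. y \<in> conf \<Longrightarrow> \<bar>f y\<bar> \<le> C * (1 + H y) ^ p"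
  shows "adm f"
  using assms by (auto simp: adm_def)

lemma adm_const: "adm (\<lambda>_. c)"
  by (rule adm_boundI[of _ "\<bar>c\<bar>" 0]) auto

lemma adm_t: "k < N \<Longrightarrow> adm (t k)"
  using t_pos t_le by (intro adm_boundI[of _ N 0]) (auto intro: measurable_t simp: less_imp_le)

lemma adm_inverse_t: assumes "k < N" shows "adm (\<lambda>y. inverse (t k y))"
proof (rule adm_boundI[of _ "1 / (\<beta> * N)" 1])
  show "(\<lambda>y. inverse (t k y)) \<in> borel_measurable L"
    using measurable_t[OF assms] by simp
  fix y assume y: "y \<in> conf"
  show "\<bar>inverse (t k y)\<bar> \<le> 1 / (\<beta> * N) * (1 + H y) ^ 1"
    using H_ge[OF y assms] t_pos[OF y assms] beta N by (simp add: field_simps)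
qed

lemma adm_inverse_s: assumes k: "k < N" shows "adm (\<lambda>y. inverse (s k y))"
proof (rule adm_boundI[of _ "1 / (\<beta> * N)" 1])
  show "(\<lambda>y. inverse (s k y)) \<in> borel_measurable L"
    using measurable_s[OF assms] by simp
  fix y assume y: "y \<in> conf"
  have "inverse (s k y) \<le> inverse (t k y)"
    using t_pos[OF y k] t_pos[OF y nx_less[of k]] by (simp add: s_def)
  moreover have "inverse (t k y) \<le> 1 / (\<beta> * N) * (1 + H y) ^ 1"
    using H_ge[OF y assms] t_pos[OF y assms] beta N by (simp add: field_simps)
  ultimately show "\<bar>inverse (s k y)\<bar> \<le> 1 / (\<beta> * N) * (1 + H y) ^ 1"
    using s_pos[OF y k] by simp
qed

text \<open>Both bounds are raised to the common exponent p + q. This is possible because the base 1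
  + \<open>H\<close> is at least 1.\<close>

lemma adm_add: assumes "adm f" "adm g" shows "adm (\<lambda>y. f y + g y)"
proof -
  obtain C p where C: "\<And>y. y \<in> conf \<Longrightarrow> \<bar>f y\<bar> \<le> C * (1 + H y) ^ p"
    using assms by (auto simp: adm_def)
  obtain D q where D: "\<And>y. y \<in> conf \<Longrightarrow> \<bar>g y\<bar> \<le> D * (1 + H y) ^ q"
    using assms by (auto simp: adm_def)
  show ?thesis
  proof (rule adm_boundI[of _ "\<bar>C\<bar> + \<bar>D\<bar>" "p + q"])
    show "(\<lambda>y. f y + g y) \<in> borel_measurable L"
      using assms by (intro borel_measurable_add adm_measurable)
    fix y assume y: "y \<in> conf"
    have H: "1 \<le> 1 + H y" using H_nonneg[OF y] by simp
    have "\<bar>f y\<bar> \<le> \<bar>C\<bar> * (1 + H y) ^ (p + q)"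
      using C[OF y] power_increasing[of p "p + q", OF _ H] H
      by (elim order_trans) (intro mult_mono, auto)
    moreover have "\<bar>g y\<bar> \<le> \<bar>D\<bar> * (1 + H y) ^ (p + q)"
      using D[OF y] power_increasing[of q "p + q", OF _ H] H
      by (elim order_trans) (intro mult_mono, auto)
    ultimately show "\<bar>f y + g y\<bar> \<le> (\<bar>C\<bar> + \<bar>D\<bar>) * (1 + H y) ^ (p + q)"
      by (simp add: distrib_right)
  qed
qed

lemma adm_mult: assumes "adm f" "adm g" shows "adm (\<lambda>y. f y * g y)"
proof -
  obtain C p where C: "\<And>y. y \<in> conf \<Longrightarrow> \<bar>f y\<bar> \<le> C * (1 + H y) ^ p"
    using assms by (auto simp: adm_def)
  obtain D q where D: "\<And>y. y \<in> conf \<Longrightarrow> \<bar>g y\<bar> \<le> D * (1 + H y) ^ q"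
    using assms by (auto simp: adm_def)
  show ?thesis
  proof (rule adm_boundI[of _ "C * D" "p + q"])
    show "(\<lambda>y. f y * g y) \<in> borel_measurable L"
      using assms by (intro borel_measurable_times adm_measurable)
    fix y assume y: "y \<in> conf"
    have "\<bar>f y * g y\<bar> \<le> (C * (1 + H y) ^ p) * (D * (1 + H y) ^ q)"
      unfolding abs_mult using C[OF y] D[OF y] by (intro mult_mono) linarith+
    then show "\<bar>f y * g y\<bar> \<le> C * D * (1 + H y) ^ (p + q)"
      by (simp add: power_add mult_ac)
  qed
qed

lemma adm_abs: "adm f \<Longrightarrow> adm (\<lambda>y. \<bar>f y\<bar>)"
  by (auto simp: adm_def)

lemma adm_uminus: "adm f \<Longrightarrow> adm (\<lambda>y. - f y)"
  using adm_mult[OF adm_const[of "-1"]] by simp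

lemma adm_diff: "adm f \<Longrightarrow> adm g \<Longrightarrow> adm (\<lambda>y. f y - g y)"
  using adm_add[OF _ adm_uminus] by simp

lemma adm_power: "adm f \<Longrightarrow> adm (\<lambda>y. f y ^ n)"
  by (induction n) (auto intro: adm_mult adm_const)

lemma adm_sum: "(\<And>i. i \<in> I \<Longrightarrow> adm (f i)) \<Longrightarrow> adm (\<lambda>y. \<Sum>i\<in>I. f i y)"
  by (induction I rule: infinite_finite_induct) (auto intro: adm_add adm_const)

lemma adm_divide: "adm f \<Longrightarrow> adm (\<lambda>y. inverse (g y)) \<Longrightarrow> adm (\<lambda>y. f y / g y)"
  unfolding divide_inverse by (rule adm_mult)

lemma adm_inverse_mult: "adm (\<lambda>y. inverse (f y)) \<Longrightarrow> adm (\<lambda>y. inverse (g y)) \<Longrightarrow>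
    adm (\<lambda>y. inverse (f y * g y))"
  unfolding inverse_mult_distrib by (rule adm_mult)

lemma adm_inverse_power: "adm (\<lambda>y. inverse (f y)) \<Longrightarrow> adm (\<lambda>y. inverse (f y ^ n))"
  unfolding power_inverse[symmetric] by (rule adm_power)

lemma adm_s: "k < N \<Longrightarrow> adm (s k)"
  unfolding s_def[abs_def] by (intro adm_add adm_t nx_less)

lemmas adm_intros = adm_const adm_t adm_s adm_inverse_t adm_inverse_s adm_add adm_mult adm_abs
  adm_uminus adm_diff adm_power adm_sum adm_divide adm_inverse_mult adm_inverse_power

section \<open>Linearity and monotonicity of the expectation\<close>

lemma E_add: "adm f \<Longrightarrow> adm g \<Longrightarrow> E (\<lambda>y. f y + g y) = E f + E g"
  by (simp add: E_def distrib_left add_divide_distrib integrable_adm)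

lemma E_diff: "adm f \<Longrightarrow> adm g \<Longrightarrow> E (\<lambda>y. f y - g y) = E f - E g"
  by (simp add: E_def right_diff_distrib diff_divide_distrib integrable_adm)

lemma E_cmult: "E (\<lambda>y. c * f y) = c * E f"
  by (simp add: E_def mult.left_commute[of _ c])

lemma E_sum: "(\<And>i. i \<in> I \<Longrightarrow> adm (f i)) \<Longrightarrow> E (\<lambda>y. \<Sum>i\<in>I. f i y) = (\<Sum>i\<in>I. E (f i))"
  by (simp add: E_def sum_distrib_left integrable_adm sum_divide_distrib)

lemma Z_nonneg: "0 \<le> Z"
  unfolding Z_def by (intro integral_nonneg_AE) (auto simp: wt_def)

lemma E_mono:
  assumes "adm f" "adm g" "\<And>y. y \<in> conf \<Longrightarrow> f y \<le> g y"
  shows "E f \<le> E g"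
  unfolding E_def using assms
  by (intro divide_right_mono Z_nonneg integral_mono integrable_adm)
    (auto simp: wt_def indicator_def)

lemma E_cong: "(\<And>y. y \<in> conf \<Longrightarrow> f y = g y) \<Longrightarrow> E f = E g"
  unfolding E_def
  by (intro arg_cong2[where f = "(/)"] Bochner_Integration.integral_cong) (auto simp: wt_def indicator_def)

lemma E_nonneg: "(\<And>y. y \<in> conf \<Longrightarrow> 0 \<le> f y) \<Longrightarrow> 0 \<le> E f"
  unfolding E_def
  by (intro divide_nonneg_nonneg Z_nonneg integral_nonneg_AE) (auto simp: wt_def indicator_def)

end

section \<open>Integration by parts and rotation invariance\<close>

context cyclic_gas
begin

text \<open>Moving \<open>y\<^sub>m\<close> increases \<open>t\<^sub>m\<^sub>-\<^sub>1\<close> and decreases \<open>t\<^sub>m\<close> at rate \<open>N\<close>; so \<open>f' i\<close> plays the role of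
  \<open>\<partial>f / \<partial>t\<^sub>i\<close>, of which only differences are visible on the simplex.\<close>

definition has_grad :: "((nat \<Rightarrow> real) \<Rightarrow> real) \<Rightarrow> (nat \<Rightarrow> (nat \<Rightarrow> real) \<Rightarrow> real) \<Rightarrow> bool" where
  "has_grad f f' \<longleftrightarrow> (\<forall>y\<in>conf. \<forall>m\<in>{1..<N}.
     ((\<lambda>x. f (y(m := x))) has_real_derivative real N * (f' (m - 1) y - f' m y)) (at (y m)))"

text \<open>The formal partial derivative of \<open>H\<close> in \<open>t i\<close>, with all gaps
  treated as independent. Site i meets the bonds k = i and \<open>nx k = i\<close>; summing over k
  with indicators avoids a cyclic predecessor.\<close>

definition H' :: "nat \<Rightarrow> (nat \<Rightarrow> real) \<Rightarrow> real" where
  "H' i y = - (\<Sum>k<N. \<beta> * real N / (t k y)\<^sup>2 * of_bool (k = i) +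
      \<gamma> * real N / (s k y)\<^sup>2 * (of_bool (k = i) + of_bool (nx k = i)))"

section \<open>Gradients along the free coordinates\<close>

lemma embed_upd:
  "m \<in> {1..<N} \<Longrightarrow> k \<le> N \<Longrightarrow> embed N (y(m := x)) k = (if k = m then x else embed N y k)"
  by (auto simp: embed_def)

lemma has_grad_t: assumes k: "k < N" shows "has_grad (t k) (\<lambda>i y. of_bool (k = i))"
  unfolding has_grad_def
proof (intro ballI)
  fix y m assume m: "m \<in> {1..<N}"
  consider "Suc k = m" | "k = m" | "Suc k \<noteq> m" "k \<noteq> m" by blast
  then show "((\<lambda>x. t k (y(m := x))) has_real_derivative
      real N * (of_bool (k = m - 1) - of_bool (k = m))) (at (y m))"
  proof cases
    case 1
    then show ?thesis using k m unfolding t_def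
      by (auto simp: embed_upd intro!: derivative_eq_intros)
  next
    case 2
    then show ?thesis using k m unfolding t_def
      by (auto simp: embed_upd intro!: derivative_eq_intros)
  next
    case 3
    then show ?thesis using k m unfolding t_def
      by (auto simp: embed_upd intro!: derivative_eq_intros)
  qed
qed

lemma has_grad_const: "has_grad (\<lambda>y. c) (\<lambda>i y. 0)"
  by (simp add: has_grad_def)

lemma has_grad_add:
  "has_grad f f' \<Longrightarrow> has_grad g g' \<Longrightarrow> has_grad (\<lambda>y. f y + g y) (\<lambda>i y. f' i y + g' i y)"
  unfolding has_grad_def by (fastforce intro!: derivative_eq_intros simp: algebra_simps)

lemma has_grad_mult:
  "has_grad f f' \<Longrightarrow> has_grad g g' \<Longrightarrow>
    has_grad (\<lambda>y. f y * g y) (\<lambda>i y. f' i y * g y + f y * g' i y)"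
  unfolding has_grad_def by (fastforce intro!: derivative_eq_intros simp: algebra_simps)

lemma has_grad_sum:
  "(\<And>k. k \<in> K \<Longrightarrow> has_grad (f k) (f' k)) \<Longrightarrow>
    has_grad (\<lambda>y. \<Sum>k\<in>K. f k y) (\<lambda>i y. \<Sum>k\<in>K. f' k i y)"
  by (induction K rule: infinite_finite_induct) (simp_all add: has_grad_const has_grad_add)

lemma has_grad_divide:
  assumes "has_grad g g'" "\<And>y. y \<in> conf \<Longrightarrow> g y \<noteq> 0"
  shows "has_grad (\<lambda>y. c / g y) (\<lambda>i y. - (c / (g y)\<^sup>2 * g' i y))"
  unfolding has_grad_def
proof (intro ballI)
  fix y m assume y: "y \<in> conf" and m: "m \<in> {1..<N}"
  have "((\<lambda>x. g (y(m := x))) has_real_derivative real N * (g' (m - 1) y - g' m y)) (at (y m))"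
    using assms(1) y m by (simp add: has_grad_def)
  then show "((\<lambda>x. c / g (y(m := x))) has_real_derivative
      real N * (- (c / (g y)\<^sup>2 * g' (m - 1) y) - - (c / (g y)\<^sup>2 * g' m y))) (at (y m))"
    using assms(2)[OF y]
    by (auto intro!: derivative_eq_intros simp: field_simps power2_eq_square)
qed

lemma has_grad_eq: "has_grad f f' \<Longrightarrow> (\<And>i y. f' i y = g' i y) \<Longrightarrow> has_grad f g'"
  by (simp add: has_grad_def)

lemma has_grad_H: "has_grad H H'"
proof -
  have s: "has_grad (s k) (\<lambda>i y. of_bool (k = i) + of_bool (nx k = i))" if "k < N" for k
    unfolding s_def[abs_def] using that nx_less by (intro has_grad_add has_grad_t)
  show ?thesis
    unfolding H_def[abs_def]
  proof (rule has_grad_eq[OF has_grad_sum])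
    fix k assume "k \<in> {..<N}"
    then have k: "k < N" by simp
    show "has_grad (\<lambda>y. \<beta> * real N / t k y + \<gamma> * real N / s k y)
      (\<lambda>i y. - (\<beta> * real N / (t k y)\<^sup>2 * of_bool (k = i)) +
        - (\<gamma> * real N / (s k y)\<^sup>2 * (of_bool (k = i) + of_bool (nx k = i))))"
      using k t_pos[OF _ k] s_pos[OF _ k]
      by (intro has_grad_add has_grad_divide has_grad_t s) force+
  qed (simp add: H'_def sum_negf sum.distrib sum_subtractf)
qed

lemma adm_H': "adm (H' i)"
  unfolding H'_def[abs_def] by (intro adm_intros) auto

text \<open>The density vanishes at both ends of the interval on which \<open>y\<^sub>m\<close> ranges. If the slice is not
  integrable, the claim holds by the convention that its integral is 0.\<close>

lemma ibp_slice:
  assumes f: "has_grad f f'" and B: "\<And>y. y \<in> conf \<Longrightarrow> \<bar>f y\<bar> \<le> B"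
    and m: "m \<in> {1..<N}" and x: "x \<in> space (\<Pi>\<^sub>M i\<in>{1..<N} - {m}. (lborel :: real measure))"
  defines "G \<equiv> \<lambda>y. (f' (m - 1) y - f y * H' (m - 1) y) - (f' m y - f y * H' m y)"
  shows "(LINT z|lborel. wt (x(m := z)) * G (x(m := z))) = 0"
proof (cases "\<exists>z. x(m := z) \<in> conf")
  case False
  then show ?thesis by (simp add: wt_def)
next
  case True
  then obtain z0 where y0: "x(m := z0) \<in> conf" by blast
  \<comment> \<open>The neighbours of y_m. They do not depend on the value \<open>z0\<close> at m,
    and they bound the interval on which y_m ranges.\<close>
  define a b where "a = embed N (x(m := z0)) (m - 1)" and "b = embed N (x(m := z0)) (Suc m)"
  have sp: "x(m := z) \<in> space L" for z
    using x m by (auto simp: space_L space_PiM PiE_iff extensional_def)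
  have tz: "t k (x(m := z)) = (if k = m then N * (b - z) else if Suc k = m then N * (z - a)
      else t k (x(m := z0)))" if "k < N" for k z
    using that m unfolding t_def a_def b_def
    by (auto simp: embed_upd[of m _ x])
  have t_ends: "t m (x(m := z)) = N * (b - z)" "t (m - 1) (x(m := z)) = N * (z - a)" for z
    using m tz[of m z] tz[of "m - 1" z] by auto
  have conf_iff: "x(m := z) \<in> conf \<longleftrightarrow> a < z \<and> z < b" for z
  proof
    assume "x(m := z) \<in> conf"
    then have "0 < t m (x(m := z))" "0 < t (m - 1) (x(m := z))"
      using m by (auto intro!: t_pos)
    then have "0 < real N * (b - z)" "0 < real N * (z - a)"
      by (simp_all only: t_ends)
    then show "a < z \<and> z < b"
      using N by (simp add: zero_less_mult_iff)
  next
    assume "a < z \<and> z < b"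
    then have "0 < t k (x(m := z))" if "k < N" for k
      using that N t_pos[OF y0 that] by (subst tz) auto
    then show "x(m := z) \<in> conf" using sp by (simp add: conf_def)
  qed
  have ab: "a < b" using conf_iff[of z0] y0 by simp
  define F where "F z = wt (x(m := z)) * f (x(m := z))" for z
  define g where "g z = real N * (wt (x(m := z)) * G (x(m := z)))" for z
  have der: "(F has_real_derivative g z) (at z)" if z: "z \<in> {a<..<b}" for z
  proof -
    define y where "y = x(m := z)"
    have y: "y \<in> conf" using z conf_iff by (simp add: y_def)
    have upd: "y(m := u) = x(m := u)" for u by (simp add: y_def)
    have "((\<lambda>u. f (y(m := u))) has_real_derivative real N * (f' (m - 1) y - f' m y)) (at (y m))"
      "((\<lambda>u. H (y(m := u))) has_real_derivative real N * (H' (m - 1) y - H' m y)) (at (y m))"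
      using f has_grad_H y m unfolding has_grad_def by blast+
    then have "((\<lambda>u. exp (- H (x(m := u))) * f (x(m := u))) has_real_derivative
        real N * (exp (- H y) * G y)) (at z)"
      unfolding upd
      by (auto intro!: derivative_eq_intros simp: y_def G_def algebra_simps)
    moreover have "real N * (exp (- H y) * G y) = g z"
      using y by (simp add: g_def wt_def y_def)
    ultimately have "((\<lambda>u. exp (- H (x(m := u))) * f (x(m := u))) has_real_derivative g z) (at z)"
      by simp
    then show ?thesis
      by (rule has_field_derivative_transform_within_open[where S = "{a<..<b}"])
        (use z conf_iff in \<open>auto simp: F_def wt_def\<close>)
  qed
  \<comment> \<open>By exp (-u) <= 1/u with u = \<beta> N / t_k, the product of weight and
    \<open>f\<close> is at most a multiple of any single gap. The two gaps adjacent to y_m give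
    continuity with value 0 at both ends.\<close>
  have bd: "\<bar>F z\<bar> \<le> \<bar>B\<bar> / (\<beta> * N) * t k (x(m := z))" if z: "x(m := z) \<in> conf" and k: "k < N" for z k
  proof -
    have pos: "0 < \<beta> * N / t k (x(m := z))"
      using t_pos[OF z k] beta N by simp
    have "\<bar>F z\<bar> = exp (- H (x(m := z))) * \<bar>f (x(m := z))\<bar>"
      using z by (simp add: F_def wt_def abs_mult)
    also have "\<dots> \<le> exp (- (\<beta> * N / t k (x(m := z)))) * \<bar>B\<bar>"
      using H_ge[OF z k] B[OF z] by (intro mult_mono) auto
    also have "\<dots> \<le> inverse (\<beta> * N / t k (x(m := z))) * \<bar>B\<bar>"
    proof (rule mult_right_mono)
      have "\<beta> * N / t k (x(m := z)) \<le> exp (\<beta> * N / t k (x(m := z)))"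
        using exp_ge_add_one_self[of "\<beta> * N / t k (x(m := z))"] by linarith
      then show "exp (- (\<beta> * N / t k (x(m := z)))) \<le> inverse (\<beta> * N / t k (x(m := z)))"
        unfolding exp_minus using pos by (rule le_imp_inverse_le)
    qed simp
    also have "\<dots> = \<bar>B\<bar> / (\<beta> * N) * t k (x(m := z))"
      by simp
    finally show ?thesis .
  qed
  have zero: "F z = 0" if "\<not> (a < z \<and> z < b)" for z
    using that conf_iff by (simp add: F_def wt_def)
  have bda: "\<bar>F z\<bar> \<le> \<bar>B\<bar> / \<beta> * \<bar>z - a\<bar>" for z
  proof (cases "a < z \<and> z < b")
    case True
    then show ?thesis
      using bd[of z "m - 1"] conf_iff[of z] m N t_ends[of z] beta by auto
  qed (use zero beta in auto)
  have bdb: "\<bar>F z\<bar> \<le> \<bar>B\<bar> / \<beta> * \<bar>z - b\<bar>" for z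
  proof (cases "a < z \<and> z < b")
    case True
    then show ?thesis
      using bd[of z m] conf_iff[of z] m N t_ends[of z] beta by (auto simp: abs_minus_commute)
  qed (use zero beta in auto)
  have cont_end: "isCont F c" if "\<And>z. \<bar>F z\<bar> \<le> C * \<bar>z - c\<bar>" for c C
  proof -
    have "F c = 0" using that[of c] by simp
    moreover have "(F \<longlongrightarrow> 0) (at c)"
    proof (rule Lim_null_comparison)
      show "\<forall>\<^sub>F z in at c. norm (F z) \<le> C * \<bar>z - c\<bar>" using that by simp
      show "((\<lambda>z. C * \<bar>z - c\<bar>) \<longlongrightarrow> 0) (at c)"
        by (rule tendsto_eq_intros refl | simp)+
    qed
    ultimately show ?thesis by (simp add: isCont_def)
  qed
  have "continuous_on {a..b} F"
  proof (rule continuous_at_imp_continuous_on, rule ballI)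
    fix z assume "z \<in> {a..b}"
    then consider "z = a" | "z = b" | "z \<in> {a<..<b}" by fastforce
    then show "isCont F z"
      using cont_end[OF bda] cont_end[OF bdb] DERIV_isCont[OF der] by cases auto
  qed
  \<comment> \<open>The gauge integral needs only continuity up to the ends and differentiability
    inside, so no integrability of \<open>g\<close> is required here.\<close>
  then have "(g has_integral F b - F a) {a..b}"
    using ab der
    by (intro fundamental_theorem_of_calculus_interior)
      (auto simp: has_real_derivative_iff_has_vector_derivative[symmetric])
  then have int: "(g has_integral 0) {a..b}"
    using zero[of a] zero[of b] by simp
  have g0: "g z = 0" if "z \<notin> {a..b}" for z
  proof -
    have "x(m := z) \<notin> conf" using that by (auto simp: conf_iff)
    then show ?thesis by (simp add: g_def wt_def)
  qed
  have int0: "(g has_integral 0) UNIV"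
    by (rule has_integral_on_superset[OF int g0]) auto
  have "integral\<^sup>L lborel g = 0"
  proof (cases "integrable lborel g")
    case True
    then show ?thesis
      using has_integral_unique[OF has_integral_integral_lborel int0] by blast
  qed (rule not_integrable_integral_eq)
  then show ?thesis
    using N by (simp add: g_def[abs_def])
qed

text \<open>Fubini with coordinate m innermost reduces the claim to \<open>ibp_slice\<close>.
  Admissibility supplies the integrability for Fubini, and the bound on \<open>f\<close> removes the
  boundary terms.\<close>

lemma ibp_coord:
  assumes f: "has_grad f f'" and B: "\<And>y. y \<in> conf \<Longrightarrow> \<bar>f y\<bar> \<le> B"
    and m: "m \<in> {1..<N}" and adm: "adm f" "\<And>i. i < N \<Longrightarrow> adm (f' i)"
  shows "E (\<lambda>y. f' (m - 1) y - f y * H' (m - 1) y) = E (\<lambda>y. f' m y - f y * H' m y)"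
proof -
  define G where "G y = (f' (m - 1) y - f y * H' (m - 1) y) - (f' m y - f y * H' m y)" for y
  interpret L: product_sigma_finite "\<lambda>_::nat. lborel :: real measure"
    by standard
  have I: "{1..<N} = insert m ({1..<N} - {m})" using m by blast
  have m': "m < N" "m - 1 < N" using m by auto
  have "adm G"
    unfolding G_def[abs_def] using m' by (intro adm_intros adm adm_H')
  then have "integrable L (\<lambda>y. wt y * G y)"
    by (rule integrable_adm)
  then have "integrable (\<Pi>\<^sub>M i\<in>insert m ({1..<N} - {m}). lborel) (\<lambda>y. wt y * G y)"
    by (simp only: I[symmetric] L_def)
  then have "(LINT y|(\<Pi>\<^sub>M i\<in>insert m ({1..<N} - {m}). lborel). wt y * G y) =
      (LINT x|(\<Pi>\<^sub>M i\<in>{1..<N} - {m}. lborel). LINT z|lborel. wt (x(m := z)) * G (x(m := z)))"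
    by (intro L.product_integral_insert) auto
  also have "\<dots> = (LINT x|(\<Pi>\<^sub>M i\<in>{1..<N} - {m}. (lborel :: real measure)). 0)"
    unfolding G_def by (intro Bochner_Integration.integral_cong refl ibp_slice[OF f B m])
  finally have "E G = 0"
    by (simp only: I[symmetric] L_def[symmetric] E_def) simp
  moreover have "E G = E (\<lambda>y. f' (m - 1) y - f y * H' (m - 1) y) - E (\<lambda>y. f' m y - f y * H' m y)"
    unfolding G_def[abs_def] using m' by (intro E_diff adm_intros adm adm_H')
  ultimately show ?thesis by simp
qed

section \<open>Rotation invariance of the expectation\<close>

lemma t_turn:
  assumes k: "k < N" shows "t k (turn N y) = t (nx k) y"
proof -
  \<comment> \<open>At i = N - 1 this reads 1 - y_1, because \<open>embed\<close> puts 1 at index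
    N.\<close>
  have e: "embed N (turn N y) i = embed N y (Suc i) - embed N y 1" if "i < N" for i
    using that N by (auto simp: turn_def embed_def)
  show ?thesis
  proof (cases "Suc k < N")
    case True
    then show ?thesis using k by (simp add: t_def nx_eq e)
  next
    case False
    then have "k = N - 1" using k by simp
    then show ?thesis
      using N e[of "N - 1"] embed_simps(2)[of "turn N y"] embed_simps(1,2)[of y] nx_eq(2)
      by (simp add: t_def)
  qed
qed

lemma s_turn: "k < N \<Longrightarrow> s k (turn N y) = s (nx k) y"
  by (simp add: s_def t_turn nx_less)

lemma turn_space: "turn N y \<in> space L"
  by (simp add: space_L turn_def)

lemma turn_measurable: "turn N \<in> L \<rightarrow>\<^sub>M L"
  unfolding L_def by (rule measurable_turn[OF N])

lemma turn_conf: assumes "y \<in> space L" shows "turn N y \<in> conf \<longleftrightarrow> y \<in> conf"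
proof -
  have "(\<forall>k<N. 0 < t (nx k) y) \<longleftrightarrow> (\<forall>k<N. 0 < t k y)"
  proof
    assume h: "\<forall>k<N. 0 < t (nx k) y"
    show "\<forall>k<N. 0 < t k y"
    proof (intro allI impI)
      fix k assume k: "k < N"
      have "k = nx (if k = 0 then N - 1 else k - 1)"
        using k N by (auto simp: nx_def)
      then show "0 < t k y"
        using h k by (metis N_pos diff_less less_imp_diff_less zero_less_one)
    qed
  qed (simp add: nx_less)
  then show ?thesis
    using assms turn_space by (simp add: conf_def t_turn)
qed

lemma H_turn: "H (turn N y) = H y"
proof -
  have "H (turn N y) = (\<Sum>k<N. \<beta> * real N / t (nx k) y + \<gamma> * real N / s (nx k) y)"
    unfolding H_def by (rule sum.cong) (auto simp: t_turn s_turn)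
  then show ?thesis
    unfolding H_def using sum_nx[of "\<lambda>k. \<beta> * real N / t k y + \<gamma> * real N / s k y"] by simp
qed

text \<open>The reference measure is invariant by \<open>distr_turn\<close>, and the weight is
  invariant because \<open>conf\<close> and \<open>H\<close> are.\<close>

lemma E_turn: assumes "f \<in> borel_measurable L" shows "E (\<lambda>y. f (turn N y)) = E f"
proof -
  have "(LINT y|L. wt y * f y) = (LINT y|distr L L (turn N). wt y * f y)"
    using distr_turn[OF N] by (simp add: L_def)
  also have "\<dots> = (LINT y|L. wt (turn N y) * f (turn N y))"
    using assms measurable_wt turn_measurable by (intro integral_distr borel_measurable_times)
  also have "\<dots> = (LINT y|L. wt y * f (turn N y))"
    by (rule Bochner_Integration.integral_cong) (auto simp: wt_def turn_conf H_turn indicator_def)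
  finally show ?thesis by (simp add: E_def)
qed

end

section \<open>Drift and fluctuations\<close>

context cyclic_gas
begin

definition w :: "nat \<Rightarrow> (nat \<Rightarrow> real) \<Rightarrow> real" where "w k y = t k y - 1"

text \<open>\<open>av\<close> and \<open>bv\<close> are the two kinds of terms of the drift, centred at \<open>t = 1\<close>; \<open>rho\<close> and \<open>sig\<close> are their
  (nonnegative) remainders after the linear Taylor term, and \<open>al = w av\<close>.\<close>

definition al :: "nat \<Rightarrow> (nat \<Rightarrow> real) \<Rightarrow> real" where
  "al k y = (w k y)\<^sup>2 * (t k y + 1) / (t k y)\<^sup>2"

definition rho :: "nat \<Rightarrow> (nat \<Rightarrow> real) \<Rightarrow> real" where
  "rho k y = (w k y)\<^sup>2 * (2 * t k y + 1) / (t k y)\<^sup>2"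

definition sig :: "nat \<Rightarrow> (nat \<Rightarrow> real) \<Rightarrow> real" where
  "sig k y = (w k y + w (nx k) y)\<^sup>2 * (s k y + 1) / (4 * (s k y)\<^sup>2)"

definition av :: "nat \<Rightarrow> (nat \<Rightarrow> real) \<Rightarrow> real" where "av k y = 1 - 1 / (t k y)\<^sup>2"

definition bv :: "nat \<Rightarrow> (nat \<Rightarrow> real) \<Rightarrow> real" where "bv k y = 1 / 4 - 1 / (s k y)\<^sup>2"

text \<open>\<open>H' i\<close> shifted by the constant that makes it vanish at t = 1 (see
  \<open>D_eq\<close>). The shift is the same for every i, so it cancels in all differences between
  sites.\<close>

definition D :: "nat \<Rightarrow> (nat \<Rightarrow> real) \<Rightarrow> real" where
  "D i y = (\<Sum>k<N. real N * (\<beta> * av k y * of_bool (k = i) +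
      \<gamma> * bv k y * (of_bool (k = i) + of_bool (nx k = i))))"

text \<open>Minus the average of \<open>D i\<close> over the sites (\<open>sum_D_1\<close>). Its
  linear part cancels on the simplex, which leaves a nonnegative second order quantity
  (\<open>R_eq\<close>).\<close>

definition R :: "(nat \<Rightarrow> real) \<Rightarrow> real" where
  "R y = - (\<Sum>k<N. \<beta> * av k y + 2 * \<gamma> * bv k y)"

definition P :: "(nat \<Rightarrow> real) \<Rightarrow> real" where "P y = (\<Sum>k<N. w k y * w k y)"

definition S :: "(nat \<Rightarrow> real) \<Rightarrow> real" where "S y = (\<Sum>k<N. w k y * D k y)"

lemma adm_w: "k < N \<Longrightarrow> adm (w k)"
  unfolding w_def[abs_def] by (intro adm_intros)

lemma adm_al: "k < N \<Longrightarrow> adm (al k)"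
  unfolding al_def[abs_def] by (intro adm_intros adm_w)

lemma adm_rho: "k < N \<Longrightarrow> adm (rho k)"
  unfolding rho_def[abs_def] by (intro adm_intros adm_w)

lemma adm_sig: "k < N \<Longrightarrow> adm (sig k)"
  unfolding sig_def[abs_def] by (intro adm_intros adm_w nx_less)

lemma adm_av: "k < N \<Longrightarrow> adm (av k)"
  unfolding av_def[abs_def] by (intro adm_intros)

lemma adm_bv: "k < N \<Longrightarrow> adm (bv k)"
  unfolding bv_def[abs_def] by (intro adm_intros)

lemma adm_D: "adm (D i)"
  unfolding D_def[abs_def] by (intro adm_intros adm_av adm_bv) auto

lemma adm_R: "adm R"
  unfolding R_def[abs_def] by (intro adm_intros adm_av adm_bv) auto

lemma adm_P: "adm P"
  unfolding P_def[abs_def] by (intro adm_intros adm_w) auto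

lemma adm_S: "adm S"
  unfolding S_def[abs_def] by (intro adm_intros adm_w adm_D) auto

lemmas adms = adm_intros adm_w adm_al adm_rho adm_sig adm_av adm_bv adm_D adm_R adm_P adm_S

section \<open>Summing the drift and the integration by parts identity\<close>

lemma sum_w: "(\<Sum>k<N. w k y) = 0"
  using sum_t[of y] by (simp add: w_def sum_subtractf)

lemma sum_nx_w: "(\<Sum>k<N. w (nx k) y) = 0"
  using sum_nx[of "\<lambda>k. w k y"] by (simp add: sum_w)

lemma sum_of_bool: "i < N \<Longrightarrow> (\<Sum>k<N. g k * of_bool (k = i)) = g i" for g :: "nat \<Rightarrow> real"
  by (subst sum.remove[of "{..<N}" i]) (auto intro!: sum.neutral)

lemma sum_of_bool_nx: assumes "i < N" shows "(\<Sum>k<N. of_bool (nx k = i)) = (1 :: real)"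
  using sum_nx[of "\<lambda>k. of_bool (k = i)"] sum_of_bool[OF assms, of "\<lambda>_. 1"] by simp

lemma D_eq: assumes "i < N" shows "D i y = H' i y + real N * (\<beta> + \<gamma> / 2)"
proof -
  have "D i y = (\<Sum>k<N. - (\<beta> * real N / (t k y)\<^sup>2 * of_bool (k = i) +
      \<gamma> * real N / (s k y)\<^sup>2 * (of_bool (k = i) + of_bool (nx k = i))) +
      real N * ((\<beta> + \<gamma> / 4) * (1 * of_bool (k = i)) + \<gamma> / 4 * of_bool (nx k = i)))"
    unfolding D_def av_def bv_def by (rule sum.cong) (auto simp: algebra_simps)
  also have "\<dots> = H' i y + real N * ((\<beta> + \<gamma> / 4) * (\<Sum>k<N. 1 * of_bool (k = i)) +
      \<gamma> / 4 * (\<Sum>k<N. of_bool (nx k = i)))"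
    unfolding H'_def sum.distrib sum_negf sum_distrib_left[symmetric] by simp
  also have "\<dots> = H' i y + real N * (\<beta> + \<gamma> / 2)"
    unfolding sum_of_bool[OF assms] sum_of_bool_nx[OF assms] by simp
  finally show ?thesis .
qed

text \<open>Summation over bonds instead of sites: the pair term of bond k acts on the two sites k
  and \<open>nx k\<close>, and so collects both values of v.\<close>

lemma sum_D: "(\<Sum>i<N. v i * D i y) = real N * (\<Sum>k<N. \<beta> * (v k * av k y) + \<gamma> * ((v k + v (nx k)) * bv k y))"
proof -
  have "(\<Sum>i<N. v i * D i y) = (\<Sum>i<N. \<Sum>k<N. v i * (real N * (\<beta> * av k y * of_bool (k = i) +
      \<gamma> * bv k y * (of_bool (k = i) + of_bool (nx k = i)))))"
    by (simp add: D_def sum_distrib_left)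
  also have "\<dots> = (\<Sum>k<N. \<Sum>i<N. v i * (real N * (\<beta> * av k y * of_bool (k = i) +
      \<gamma> * bv k y * (of_bool (k = i) + of_bool (nx k = i)))))"
    by (rule sum.swap)
  also have "\<dots> = (\<Sum>k<N. real N * (\<beta> * (v k * av k y) + \<gamma> * ((v k + v (nx k)) * bv k y)))"
  proof (rule sum.cong[OF refl])
    fix k assume "k \<in> {..<N}"
    then have k: "k < N" by simp
    have "(\<Sum>i<N. v i * (real N * (\<beta> * av k y * of_bool (k = i) +
        \<gamma> * bv k y * (of_bool (k = i) + of_bool (nx k = i))))) =
      (\<Sum>i<N. (real N * (\<beta> * av k y + \<gamma> * bv k y) * v i) * of_bool (i = k)
         + (real N * \<gamma> * bv k y * v i) * of_bool (i = nx k))"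
      by (rule sum.cong) (auto simp: algebra_simps)
    also have "\<dots> = real N * (\<beta> * av k y + \<gamma> * bv k y) * v k + real N * \<gamma> * bv k y * v (nx k)"
      unfolding sum.distrib sum_of_bool[OF k] sum_of_bool[OF nx_less] by simp
    finally show "(\<Sum>i<N. v i * (real N * (\<beta> * av k y * of_bool (k = i) +
        \<gamma> * bv k y * (of_bool (k = i) + of_bool (nx k = i))))) =
      real N * (\<beta> * (v k * av k y) + \<gamma> * ((v k + v (nx k)) * bv k y))"
      by (simp add: algebra_simps)
  qed
  finally show ?thesis
    by (simp add: sum_distrib_left)
qed

lemma sum_D_1: "(\<Sum>i<N. D i y) = - (real N * R y)"
  using sum_D[of "\<lambda>_. 1" y] by (simp add: R_def mult_ac)

text \<open>By \<open>ibp_coord\<close> the quantity E (f'_i - f D_i) is the same for all i, since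
  passing from \<open>H'\<close> to \<open>D\<close> subtracts the same multiple of E f everywhere.
  Its value at k is therefore its average over i, and there the drifts sum to -N R.\<close>

lemma ibp:
  assumes f: "has_grad f f'" and B: "\<And>y. y \<in> conf \<Longrightarrow> \<bar>f y\<bar> \<le> B"
    and adm: "adm f" "\<And>i. i < N \<Longrightarrow> adm (f' i)"
    and k: "k < N"
  shows "E (f' k) - E (\<lambda>y. f y * D k y) = (\<Sum>i<N. E (f' i)) / N + E (\<lambda>y. f y * R y)"
proof -
  define e where "e i = E (f' i) - E (\<lambda>y. f y * D i y)" for i
  have e_eq: "e i = E (\<lambda>y. f' i y - f y * H' i y) - real N * (\<beta> + \<gamma> / 2) * E f" if "i < N" for i
  proof -
    have "E (\<lambda>y. f y * D i y) = E (\<lambda>y. f y * H' i y + real N * (\<beta> + \<gamma> / 2) * f y)"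
      by (rule E_cong) (simp add: D_eq[OF that] algebra_simps)
    also have "\<dots> = E (\<lambda>y. f y * H' i y) + real N * (\<beta> + \<gamma> / 2) * E f"
      by (subst E_add) (auto intro!: adms adm adm_H' simp: E_cmult)
    finally show ?thesis
      unfolding e_def using that by (subst E_diff) (auto intro!: adms adm adm_H')
  qed
  have e0: "e i = e 0" if "i < N" for i
    using that
  proof (induction i)
    case (Suc i)
    have "e (Suc i - 1) = e (Suc i)"
      using ibp_coord[OF f B _ adm, of "Suc i"] Suc.prems by (simp add: e_eq)
    with Suc show ?case by simp
  qed simp
  have "(\<Sum>i<N. e i) = (\<Sum>i<N. e 0)"
    by (rule sum.cong[OF refl], rule e0) simp
  then have "(\<Sum>i<N. e i) = real N * e k"
    unfolding e0[OF k] by simp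
  moreover have "(\<Sum>i<N. e i) = (\<Sum>i<N. E (f' i)) - E (\<lambda>y. \<Sum>i<N. f y * D i y)"
    unfolding e_def sum_subtractf by (subst E_sum) (auto intro!: adms adm)
  moreover have "(\<lambda>y. \<Sum>i<N. f y * D i y) = (\<lambda>y. - real N * (f y * R y))"
    by (simp add: sum_distrib_left[symmetric] sum_D_1 fun_eq_iff)
  ultimately have "real N * e k = (\<Sum>i<N. E (f' i)) + real N * E (\<lambda>y. f y * R y)"
    by (simp only: E_cmult)
  then show ?thesis
    using N unfolding e_def by (simp add: field_simps)
qed

lemma has_grad_w: "k < N \<Longrightarrow> has_grad (w k) (\<lambda>i y. of_bool (k = i))"
  using has_grad_add[OF has_grad_t has_grad_const[of "-1"]]
  by (simp add: w_def[abs_def])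

section \<open>Pointwise inequalities for drift and remainders\<close>

lemma w_bound: "y \<in> conf \<Longrightarrow> k < N \<Longrightarrow> \<bar>w k y\<bar> \<le> N"
  using t_pos[of y k] t_le[of y k] N by (simp add: w_def)

lemma w_gt: "y \<in> conf \<Longrightarrow> k < N \<Longrightarrow> - 1 < w k y"
  using t_pos by (simp add: w_def)

lemma P_nonneg: "0 \<le> P y"
  unfolding P_def by (intro sum_nonneg) simp

text \<open>A crude bound, needed only for the boundedness condition of \<open>ibp\<close>.\<close>

lemma P_bound: assumes "y \<in> conf" shows "P y \<le> real N * (real N * real N)"
proof -
  have "w k y * w k y \<le> real N * real N" if "k < N" for k
    using abs_mult_self_eq[of "w k y"] mult_mono[OF w_bound[OF assms that] w_bound[OF assms that]] by simp
  then have "P y \<le> (\<Sum>k<N. real N * real N)"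
    unfolding P_def by (intro sum_mono) simp
  then show ?thesis by simp
qed

lemma w_av: assumes "y \<in> conf" "k < N" shows "w k y * av k y = al k y"
  using t_pos[OF assms] by (simp add: w_def av_def al_def field_simps power2_eq_square)

lemma av_rho: assumes "y \<in> conf" "k < N" shows "av k y = 2 * w k y - rho k y"
  using t_pos[OF assms] by (simp add: w_def av_def rho_def field_simps power2_eq_square)

lemma bv_sig: assumes "y \<in> conf" "k < N" shows "bv k y = (w k y + w (nx k) y) / 4 - sig k y"
proof -
  have e: "w k y + w (nx k) y = s k y - 2" by (simp add: w_def s_def)
  show ?thesis
    unfolding sig_def e using s_pos[OF assms] by (simp add: bv_def field_simps power2_eq_square)
qed

text \<open>The right-hand side has the same form as \<open>sig\<close>, with the factor s + 2 in
  place of s + 1.\<close>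

lemma bv_w: assumes "y \<in> conf" "k < N"
  shows "sig k y \<le> (w k y + w (nx k) y) * bv k y"
proof -
  have e: "w k y + w (nx k) y = s k y - 2" by (simp add: w_def s_def)
  have "(s k y - 2) * bv k y = (s k y - 2)\<^sup>2 * (s k y + 2) / (4 * (s k y)\<^sup>2)"
    using s_pos[OF assms] by (simp add: bv_def field_simps power2_eq_square)
  then show ?thesis
    unfolding e sig_def using s_pos[OF assms] by (simp add: divide_right_mono mult_left_mono)
qed

lemma al_nonneg: "y \<in> conf \<Longrightarrow> k < N \<Longrightarrow> 0 \<le> al k y"
  using t_pos[of y k] by (simp add: al_def)

lemma rho_nonneg: "y \<in> conf \<Longrightarrow> k < N \<Longrightarrow> 0 \<le> rho k y"
  using t_pos[of y k] by (simp add: rho_def)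

lemma sig_nonneg: "y \<in> conf \<Longrightarrow> k < N \<Longrightarrow> 0 \<le> sig k y"
  using s_pos[of y k] by (simp add: sig_def)

lemma rho_le_al: "y \<in> conf \<Longrightarrow> k < N \<Longrightarrow> rho k y \<le> 2 * al k y"
  using t_pos[of y k] by (auto simp: al_def rho_def algebra_simps intro!: divide_right_mono)

text \<open>\<open>rho\<close> and \<open>sig\<close> are 1/x^2 minus its tangent, at 1 and at 2.
  The linear parts on both sides agree, so the claim is midpoint convexity of 1/x^2.\<close>

lemma sig_le_rho: assumes y: "y \<in> conf" "k < N" shows "sig k y \<le> (rho k y + rho (nx k) y) / 8"
proof -
  have c: "8 / (a + b)\<^sup>2 \<le> 1 / a\<^sup>2 + 1 / b\<^sup>2" if "0 < a" "0 < b" for a b :: real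
  proof -
    have "8 * (a\<^sup>2 * b\<^sup>2) \<le> (a\<^sup>2 + b\<^sup>2) * (a + b)\<^sup>2"
    proof -
      have "2 * (a * b) \<le> a\<^sup>2 + b\<^sup>2" "4 * (a * b) \<le> (a + b)\<^sup>2"
        using zero_le_power2[of "a - b"] by (simp_all add: power2_eq_square algebra_simps)
      then have "(2 * (a * b)) * (4 * (a * b)) \<le> (a\<^sup>2 + b\<^sup>2) * (a + b)\<^sup>2"
        using that by (intro mult_mono) auto
      then show ?thesis by (simp add: power2_eq_square algebra_simps)
    qed
    then have "8 / (a + b)\<^sup>2 \<le> (a\<^sup>2 + b\<^sup>2) / (a\<^sup>2 * b\<^sup>2)"
      using that by (simp add: divide_le_eq pos_le_divide_eq field_simps)
    also have "\<dots> = 1 / a\<^sup>2 + 1 / b\<^sup>2"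
      using that by (simp add: field_simps)
    finally show ?thesis .
  qed
  have "rho k y = 1 / (t k y)\<^sup>2 - 1 + 2 * w k y" "rho (nx k) y = 1 / (t (nx k) y)\<^sup>2 - 1 + 2 * w (nx k) y"
    "sig k y = 1 / (s k y)\<^sup>2 - 1 / 4 + (w k y + w (nx k) y) / 4"
    using av_rho[OF y] av_rho[OF y(1) nx_less[of k]] bv_sig[OF y] by (simp_all add: av_def bv_def)
  moreover have "8 * (1 / (s k y)\<^sup>2) \<le> 1 / (t k y)\<^sup>2 + 1 / (t (nx k) y)\<^sup>2"
    using c[OF t_pos[OF y] t_pos[OF y(1) nx_less[of k]]] by (simp add: s_def)
  moreover have "z \<le> (p + q) / 8"
    if "p = a - 1 + 2 * u" "q = b - 1 + 2 * v" "z = c - 1 / 4 + (u + v) / 4" "8 * c \<le> a + b"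
    for a b c p q z u v :: real
    using that by (simp add: field_simps)
  ultimately show ?thesis by blast
qed

lemma S_eq: "S y = real N * (\<Sum>k<N. \<beta> * (w k y * av k y) + \<gamma> * ((w k y + w (nx k) y) * bv k y))"
  unfolding S_def by (rule sum_D)

text \<open>The first order Taylor terms cancel because the fluctuations \<open>w\<close> sum to
  0.\<close>

lemma R_eq: assumes "y \<in> conf" shows "R y = (\<Sum>k<N. \<beta> * rho k y + 2 * \<gamma> * sig k y)"
proof -
  have "R y = (\<Sum>k<N. (\<beta> * rho k y + 2 * \<gamma> * sig k y) - (2 * \<beta> + \<gamma> / 2) * w k y - \<gamma> / 2 * w (nx k) y)"
    unfolding R_def sum_negf[symmetric] using assms
    by (intro sum.cong) (auto simp: av_rho bv_sig algebra_simps)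
  also have "\<dots> = (\<Sum>k<N. \<beta> * rho k y + 2 * \<gamma> * sig k y) - (2 * \<beta> + \<gamma> / 2) * (\<Sum>k<N. w k y) -
      \<gamma> / 2 * (\<Sum>k<N. w (nx k) y)"
    by (simp only: sum_subtractf sum_distrib_left)
  finally show ?thesis by (simp add: sum_w sum_nx_w)
qed

lemma R_nonneg: "y \<in> conf \<Longrightarrow> 0 \<le> R y"
  using beta gamma
  by (auto simp: R_eq intro!: sum_nonneg add_nonneg_nonneg mult_nonneg_nonneg rho_nonneg sig_nonneg)

lemma sum_al_le_S: assumes "y \<in> conf" shows "real N * \<beta> * (\<Sum>k<N. al k y) \<le> S y"
proof -
  have "\<beta> * (\<Sum>k<N. al k y) \<le> (\<Sum>k<N. \<beta> * (w k y * av k y) + \<gamma> * ((w k y + w (nx k) y) * bv k y))"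
    unfolding sum_distrib_left
  proof (rule sum_mono)
    fix k assume "k \<in> {..<N}"
    then have k: "k < N" by simp
    have "0 \<le> \<gamma> * ((w k y + w (nx k) y) * bv k y)"
      using bv_w[OF assms k] sig_nonneg[OF assms k] gamma by (intro mult_nonneg_nonneg[of \<gamma>]) linarith+
    then show "\<beta> * al k y \<le> \<beta> * (w k y * av k y) + \<gamma> * ((w k y + w (nx k) y) * bv k y)"
      by (simp add: w_av[OF assms k])
  qed
  then show ?thesis
    unfolding S_eq using N by (simp add: mult.assoc)
qed

text \<open>Term by term, \<open>rho\<close> is at most 2 \<open>al\<close> and \<open>sig\<close>
  is at most its counterpart in \<open>S\<close>. This lets the radial identity for \<open>S\<close>
  control \<open>R\<close>.\<close>

lemma R_le_S: assumes "y \<in> conf" shows "real N * R y \<le> 2 * S y"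
proof -
  have "R y \<le> 2 * (\<Sum>k<N. \<beta> * (w k y * av k y) + \<gamma> * ((w k y + w (nx k) y) * bv k y))"
    unfolding R_eq[OF assms] sum_distrib_left
  proof (rule sum_mono)
    fix k assume "k \<in> {..<N}"
    then have k: "k < N" by simp
    have "\<beta> * rho k y \<le> \<beta> * (2 * al k y)" "\<gamma> * sig k y \<le> \<gamma> * ((w k y + w (nx k) y) * bv k y)"
      using rho_le_al[OF assms k] bv_w[OF assms k] beta gamma by (simp_all add: mult_left_mono)
    then show "\<beta> * rho k y + 2 * \<gamma> * sig k y
        \<le> 2 * (\<beta> * (w k y * av k y) + \<gamma> * ((w k y + w (nx k) y) * bv k y))"
      by (simp add: w_av[OF assms k])
  qed
  then show ?thesis
    unfolding S_eq using N by (simp add: mult.left_commute)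
qed

text \<open>The interaction terms have the right sign since \<open>a\<^sup>3 + b\<^sup>3\<close> and \<open>a + b\<close> have the same sign.\<close>

lemma cubic_le: assumes "y \<in> conf"
  shows "real N * \<beta> * (\<Sum>k<N. (w k y)\<^sup>2 * al k y) \<le> (\<Sum>k<N. w k y * w k y * w k y * D k y)"
proof -
  have "\<beta> * (\<Sum>k<N. (w k y)\<^sup>2 * al k y) \<le> (\<Sum>k<N. \<beta> * (w k y * w k y * w k y * av k y) +
      \<gamma> * ((w k y * w k y * w k y + w (nx k) y * w (nx k) y * w (nx k) y) * bv k y))"
    unfolding sum_distrib_left
  proof (rule sum_mono)
    fix k assume "k \<in> {..<N}"
    then have k: "k < N" by simp
    let ?a = "w k y" and ?b = "w (nx k) y"
    have f: "?a * ?a * ?a + ?b * ?b * ?b = (?a + ?b) * (((?a - ?b)\<^sup>2 + ?a\<^sup>2 + ?b\<^sup>2) / 2)"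
      by (simp add: power2_eq_square algebra_simps)
    have "0 \<le> ((?a - ?b)\<^sup>2 + ?a\<^sup>2 + ?b\<^sup>2) / 2 * ((?a + ?b) * bv k y)"
      using order_trans[OF sig_nonneg[OF assms k] bv_w[OF assms k]] by (rule mult_nonneg_nonneg[rotated]) simp
    then have "0 \<le> \<gamma> * ((?a * ?a * ?a + ?b * ?b * ?b) * bv k y)"
      unfolding f using gamma by (simp add: mult_ac)
    moreover have "?a * ?a * ?a * av k y = ?a\<^sup>2 * al k y"
      unfolding w_av[OF assms k, symmetric] by (simp add: power2_eq_square)
    ultimately show "\<beta> * (?a\<^sup>2 * al k y) \<le> \<beta> * (?a * ?a * ?a * av k y) +
        \<gamma> * ((?a * ?a * ?a + ?b * ?b * ?b) * bv k y)"
      by simp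
  qed
  then show ?thesis
    unfolding sum_D using N by (simp add: mult.assoc)
qed

text \<open>For large t, \<open>al\<close> grows only linearly and cannot dominate w^2; the second
  term grows cubically and makes up for it. Dividing by w^2 leaves a polynomial inequality in
  t.\<close>

lemma w2_le: assumes "y \<in> conf" "k < N"
  shows "w k y * w k y \<le> 4 / 3 * (al k y + (w k y)\<^sup>2 * al k y)"
proof -
  let ?t = "t k y"
  have t: "0 < ?t" by (rule t_pos[OF assms])
  have "3 * ?t\<^sup>2 \<le> 4 * (?t + 1) * (1 + (?t - 1)\<^sup>2)"
  proof -
    have "0 \<le> 4 * ?t * (?t - 1)\<^sup>2 + (?t - 2)\<^sup>2 + 4"
      using t by simp
    moreover have "4 * (?t + 1) * (1 + (?t - 1)\<^sup>2) - 3 * ?t\<^sup>2 =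
        4 * ?t * (?t - 1)\<^sup>2 + (?t - 2)\<^sup>2 + 4"
      by (simp add: power2_eq_square algebra_simps)
    ultimately show ?thesis by linarith
  qed
  then have "1 \<le> 4 / 3 * ((?t + 1) / ?t\<^sup>2 * (1 + (w k y)\<^sup>2))"
    using t by (simp add: w_def field_simps)
  then have "(w k y)\<^sup>2 * 1 \<le> (w k y)\<^sup>2 * (4 / 3 * ((?t + 1) / ?t\<^sup>2 * (1 + (w k y)\<^sup>2)))"
    by (intro mult_left_mono) auto
  moreover have "al k y = (w k y)\<^sup>2 * ((?t + 1) / ?t\<^sup>2)"
    by (simp add: al_def)
  ultimately show ?thesis
    by (simp only: power2_eq_square mult_1_right) (simp only: algebra_simps)
qed

end

section \<open>Moment bounds\<close>

text \<open>Nonvanishing of \<open>Z\<close> is obtained later from the existence of a random vector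
  with the Gibbs density (\<open>Z_nonzero\<close>).\<close>

locale cyclic_gas_normalizable = cyclic_gas +
  assumes Z: "Z \<noteq> 0"
begin

section \<open>Exact identities from integration by parts\<close>

lemma E_const: "E (\<lambda>_. c) = c"
  using Z by (simp add: E_def Z_def)

text \<open>Apply \<open>ibp\<close> to f = w_k at site k and sum over k. The derivatives contribute
  N, their averages contribute 1, and the terms with \<open>R\<close> cancel since the
  \<open>w\<close> sum to 0.\<close>

lemma E_S: "E S = real N - 1"
proof -
  have 1: "1 - E (\<lambda>y. w k y * D k y) = 1 / N + E (\<lambda>y. w k y * R y)" if k: "k < N" for k
    using ibp[OF has_grad_w[OF k] w_bound[OF _ k] adm_w[OF k] adm_const k] k
    by (simp add: E_const sum_of_bool[OF k, of "\<lambda>_. 1", simplified] eq_commute[of k])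
  have "(\<Sum>k<N. 1 - E (\<lambda>y. w k y * D k y)) = (\<Sum>k<N. 1 / N + E (\<lambda>y. w k y * R y))"
    using 1 by (intro sum.cong) auto
  then have "real N - (\<Sum>k<N. E (\<lambda>y. w k y * D k y)) = 1 + (\<Sum>k<N. E (\<lambda>y. w k y * R y))"
    using N by (simp add: sum_subtractf sum.distrib)
  moreover have "(\<Sum>k<N. E (\<lambda>y. w k y * D k y)) = E S"
    unfolding S_def[abs_def] by (rule E_sum[symmetric]) (auto intro!: adms)
  moreover have "(\<Sum>k<N. E (\<lambda>y. w k y * R y)) = E (\<lambda>y. \<Sum>k<N. w k y * R y)"
    by (rule E_sum[symmetric]) (auto intro!: adms)
  moreover have "(\<lambda>y. \<Sum>k<N. w k y * R y) = (\<lambda>y. 0)"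
    by (simp add: sum_distrib_right[symmetric] sum_w)
  ultimately show ?thesis by (simp add: E_const)
qed

lemma has_grad_P: "has_grad P (\<lambda>i y. \<Sum>j<N. of_bool (j = i) * w j y + w j y * of_bool (j = i))"
  unfolding P_def[abs_def]
  by (intro has_grad_sum has_grad_mult[OF has_grad_w has_grad_w]) auto

text \<open>Apply \<open>ibp\<close> to f = w_k P at site k and sum. The diagonal derivatives add up
  to (N + 2) P. For each k the derivatives over all sites add up to P, because the cross terms w_k
  w_i sum to 0 over i. The \<open>R\<close> terms cancel again.\<close>

lemma E_P_S: "E (\<lambda>y. P y * S y) = (real N + 1) * E P"
proof -
  let ?g = "\<lambda>k i y. of_bool (k = i) * P y +
      w k y * (\<Sum>j<N. of_bool (j = i) * w j y + w j y * of_bool (j = i))"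
  have g: "?g k i y = P y * of_bool (k = i) + 2 * (w k y * w i y)" if "i < N" for k i y
  proof -
    have "(\<Sum>j<N. of_bool (j = i) * w j y + w j y * of_bool (j = i)) =
        (\<Sum>j<N. (2 * w j y) * of_bool (j = i))"
      by (rule sum.cong) auto
    then show ?thesis
      unfolding sum_of_bool[OF that] by simp
  qed
  have 1: "E (\<lambda>y. P y + 2 * (w k y * w k y)) - E (\<lambda>y. (w k y * P y) * D k y) =
      (E P + 2 * E (\<lambda>y. \<Sum>i<N. w k y * w i y)) / N + E (\<lambda>y. (w k y * P y) * R y)"
    if k: "k < N" for k
  proof -
    have "\<bar>w k y * P y\<bar> \<le> real N * (real N * (real N * real N))" if "y \<in> conf" for y
      unfolding abs_mult using w_bound[OF that k] P_bound[OF that] P_nonneg[of y]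
      by (intro mult_mono) auto
    moreover have "adm (\<lambda>y. w k y * P y)" "adm (?g k i)" for i
      using k by (intro adms; simp)+
    ultimately have "E (?g k k) - E (\<lambda>y. (w k y * P y) * D k y) =
        (\<Sum>i<N. E (?g k i)) / N + E (\<lambda>y. (w k y * P y) * R y)"
      by (intro ibp[OF has_grad_mult[OF has_grad_w[OF k] has_grad_P] _ _ _ k])
    moreover have "E (?g k k) = E (\<lambda>y. P y + 2 * (w k y * w k y))"
      by (rule E_cong) (simp only: g[OF k], simp)
    moreover have "(\<Sum>i<N. E (?g k i)) = E (\<lambda>y. \<Sum>i<N. ?g k i y)"
      by (rule E_sum[symmetric]) (use k in \<open>auto intro!: adms\<close>)
    moreover have "E (\<lambda>y. \<Sum>i<N. ?g k i y) = E (\<lambda>y. P y + 2 * (\<Sum>i<N. w k y * w i y))"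
    proof (rule E_cong)
      fix y
      have "(\<Sum>i<N. ?g k i y) = (\<Sum>i<N. P y * of_bool (i = k) + 2 * (w k y * w i y))"
        by (rule sum.cong[OF refl], subst g) (auto simp: eq_commute)
      then show "(\<Sum>i<N. ?g k i y) = P y + 2 * (\<Sum>i<N. w k y * w i y)"
        by (simp only: sum.distrib sum_distrib_left sum_of_bool[OF k])
    qed
    moreover have "E (\<lambda>y. P y + 2 * (\<Sum>i<N. w k y * w i y)) = E P + 2 * E (\<lambda>y. \<Sum>i<N. w k y * w i y)"
      by (subst E_add) (use k in \<open>auto intro!: adms simp: E_cmult\<close>)
    ultimately show ?thesis by simp
  qed
  have "(\<lambda>y. \<Sum>i<N. w k y * w i y) = (\<lambda>y. 0)" for k
    by (simp add: sum_distrib_left[symmetric] sum_w)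
  then have "(\<Sum>k<N. E (\<lambda>y. P y + 2 * (w k y * w k y)) - E (\<lambda>y. (w k y * P y) * D k y)) =
      (\<Sum>k<N. E P / N + E (\<lambda>y. (w k y * P y) * R y))"
    using 1 by (intro sum.cong) (auto simp: E_const)
  then have "(\<Sum>k<N. E (\<lambda>y. P y + 2 * (w k y * w k y))) - (\<Sum>k<N. E (\<lambda>y. (w k y * P y) * D k y)) =
      E P + (\<Sum>k<N. E (\<lambda>y. (w k y * P y) * R y))"
    using N by (simp add: sum_subtractf sum.distrib)
  moreover have "(\<Sum>k<N. E (\<lambda>y. P y + 2 * (w k y * w k y))) = E (\<lambda>y. \<Sum>k<N. P y + 2 * (w k y * w k y))"
    by (rule E_sum[symmetric]) (auto intro!: adms)
  moreover have "(\<lambda>y. \<Sum>k<N. P y + 2 * (w k y * w k y)) = (\<lambda>y. (real N + 2) * P y)"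
    by (simp add: sum.distrib sum_distrib_left[symmetric] P_def[symmetric] algebra_simps)
  moreover have "(\<Sum>k<N. E (\<lambda>y. (w k y * P y) * D k y)) = E (\<lambda>y. \<Sum>k<N. (w k y * P y) * D k y)"
    by (rule E_sum[symmetric]) (auto intro!: adms)
  moreover have "(\<lambda>y. \<Sum>k<N. (w k y * P y) * D k y) = (\<lambda>y. P y * S y)"
    by (simp add: S_def sum_distrib_left mult_ac)
  moreover have "(\<Sum>k<N. E (\<lambda>y. (w k y * P y) * R y)) = E (\<lambda>y. \<Sum>k<N. (w k y * P y) * R y)"
    by (rule E_sum[symmetric]) (auto intro!: adms)
  moreover have "(\<lambda>y. \<Sum>k<N. (w k y * P y) * R y) = (\<lambda>y. 0)"
    by (simp add: sum_distrib_right[symmetric] sum_w)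
  ultimately have "(real N + 2) * E P - E (\<lambda>y. P y * S y) = E P + 0"
    by (simp only: E_cmult E_const)
  then show ?thesis
    by (simp add: algebra_simps)
qed

text \<open>Now f = w_k^3, differentiated only at its own site. The \<open>R\<close> term survives
  here, since the cubes do not sum to 0.\<close>

lemma E_cubic: "E (\<lambda>y. \<Sum>k<N. w k y * w k y * w k y * D k y) =
    3 * (1 - 1 / N) * E P - E (\<lambda>y. (\<Sum>k<N. w k y * w k y * w k y) * R y)"
proof -
  let ?g = "\<lambda>k i y. (of_bool (k = i) * w k y + w k y * of_bool (k = i)) * w k y +
      w k y * w k y * of_bool (k = i)"
  have g: "?g k i y = 3 * (w k y * w k y) * of_bool (i = k)" for k i y
    by (simp add: eq_commute[of k])
  have 1: "E (\<lambda>y. 3 * (w k y * w k y)) - E (\<lambda>y. (w k y * w k y * w k y) * D k y) =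
      E (\<lambda>y. 3 * (w k y * w k y)) / N + E (\<lambda>y. (w k y * w k y * w k y) * R y)"
    if k: "k < N" for k
  proof -
    have "\<bar>w k y * w k y * w k y\<bar> \<le> real N * real N * real N" if "y \<in> conf" for y
      unfolding abs_mult using w_bound[OF that k] by (intro mult_mono) auto
    moreover have "adm (\<lambda>y. w k y * w k y * w k y)" "adm (?g k i)" for i
      using k by (intro adms; simp)+
    ultimately have "E (?g k k) - E (\<lambda>y. (w k y * w k y * w k y) * D k y) =
        (\<Sum>i<N. E (?g k i)) / N + E (\<lambda>y. (w k y * w k y * w k y) * R y)"
      by (intro ibp[OF has_grad_mult[OF has_grad_mult[OF has_grad_w[OF k] has_grad_w[OF k]] has_grad_w[OF k]] _ _ _ k])
    moreover have "(\<Sum>i<N. E (?g k i)) = (\<Sum>i<N. E (\<lambda>y. 3 * (w k y * w k y)) * of_bool (i = k))"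
      by (rule sum.cong) (auto simp: E_const E_cmult)
    ultimately show ?thesis
      by (simp only: sum_of_bool[OF k]) simp
  qed
  have "(\<Sum>k<N. E (\<lambda>y. 3 * (w k y * w k y)) - E (\<lambda>y. (w k y * w k y * w k y) * D k y)) =
      (\<Sum>k<N. E (\<lambda>y. 3 * (w k y * w k y)) / N + E (\<lambda>y. (w k y * w k y * w k y) * R y))"
    using 1 by (intro sum.cong) auto
  then have "(\<Sum>k<N. E (\<lambda>y. 3 * (w k y * w k y))) - (\<Sum>k<N. E (\<lambda>y. (w k y * w k y * w k y) * D k y)) =
      (\<Sum>k<N. E (\<lambda>y. 3 * (w k y * w k y))) / N + (\<Sum>k<N. E (\<lambda>y. (w k y * w k y * w k y) * R y))"
    by (simp add: sum_subtractf sum.distrib sum_divide_distrib)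
  moreover have "(\<Sum>k<N. E (\<lambda>y. 3 * (w k y * w k y))) = 3 * E P"
    unfolding E_cmult P_def[abs_def] sum_distrib_left[symmetric]
    by (subst E_sum) (auto intro!: adms)
  moreover have "(\<Sum>k<N. E (\<lambda>y. (w k y * w k y * w k y) * D k y)) =
      E (\<lambda>y. \<Sum>k<N. w k y * w k y * w k y * D k y)"
    by (rule E_sum[symmetric]) (auto intro!: adms)
  moreover have "(\<Sum>k<N. E (\<lambda>y. (w k y * w k y * w k y) * R y)) =
      E (\<lambda>y. (\<Sum>k<N. w k y * w k y * w k y) * R y)"
    unfolding sum_distrib_right by (rule E_sum[symmetric]) (auto intro!: adms)
  ultimately show ?thesis
    by (simp add: algebra_simps)
qed

text \<open>Near t = 1, \<open>al\<close> is about 2 w^2, so this plays the role of the total fourth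
  moment.\<close>

definition quartic :: real where "quartic = E (\<lambda>y. \<Sum>k<N. (w k y)\<^sup>2 * al k y)"

section \<open>Closing the second and fourth moment bounds\<close>

lemma E_P_nonneg: "0 \<le> E P"
  by (rule E_nonneg) (rule P_nonneg)

text \<open>\<open>cubic_le\<close> bounds the left side by the expectation in
  \<open>E_cubic\<close>. In its \<open>R\<close> term, w > -1 replaces the negated cubes by
  \<open>P\<close>, \<open>R_le_S\<close> replaces \<open>R\<close> by 2 S / N, and
  \<open>E_P_S\<close> evaluates the result. Each of the two terms contributes at most 3 E
  P.\<close>

lemma quartic_le: "real N * \<beta> * quartic \<le> 6 * E P"
proof -
  have "real N * \<beta> * quartic = E (\<lambda>y. real N * \<beta> * (\<Sum>k<N. (w k y)\<^sup>2 * al k y))"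
    by (simp add: quartic_def E_cmult)
  also have "\<dots> \<le> E (\<lambda>y. \<Sum>k<N. w k y * w k y * w k y * D k y)"
    by (rule E_mono) (auto intro!: adms cubic_le)
  also have "\<dots> = 3 * (1 - 1 / N) * E P + E (\<lambda>y. - 1 * ((\<Sum>k<N. w k y * w k y * w k y) * R y))"
    unfolding E_cubic E_cmult by simp
  also have "\<dots> \<le> 3 * E P + E (\<lambda>y. 2 / N * (P y * S y))"
  proof (rule add_mono)
    show "3 * (1 - 1 / N) * E P \<le> 3 * E P"
      using E_P_nonneg by (simp add: algebra_simps)
    show "E (\<lambda>y. - 1 * ((\<Sum>k<N. w k y * w k y * w k y) * R y)) \<le> E (\<lambda>y. 2 / N * (P y * S y))"
    proof (rule E_mono)
      fix y assume y: "y \<in> conf"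
      have "- (\<Sum>k<N. w k y * w k y * w k y) \<le> P y"
        unfolding P_def sum_negf[symmetric]
      proof (rule sum_mono)
        fix k assume "k \<in> {..<N}"
        then have "- (w k y) \<le> 1" using w_gt[OF y, of k] by simp
        then have "- (w k y) * (w k y * w k y) \<le> 1 * (w k y * w k y)"
          by (intro mult_right_mono) auto
        then show "- (w k y * w k y * w k y) \<le> w k y * w k y" by (simp add: mult_ac)
      qed
      then have "- (\<Sum>k<N. w k y * w k y * w k y) * R y \<le> P y * R y"
        using R_nonneg[OF y] by (rule mult_right_mono)
      also have "\<dots> \<le> P y * (2 * S y / N)"
        using R_le_S[OF y] P_nonneg N by (intro mult_left_mono) (auto simp: field_simps)
      finally show "- 1 * ((\<Sum>k<N. w k y * w k y * w k y) * R y) \<le> 2 / N * (P y * S y)"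
        by (simp add: mult_ac)
    qed (auto intro!: adms)
  qed
  also have "\<dots> = 3 * E P + 2 / N * ((real N + 1) * E P)"
    by (simp only: E_cmult E_P_S)
  also have "\<dots> \<le> 6 * E P"
  proof -
    have "2 / N * (real N + 1) \<le> 3" using N by (simp add: field_simps)
    then have "2 / N * (real N + 1) * E P \<le> 3 * E P"
      using E_P_nonneg by (rule mult_right_mono)
    then show ?thesis by (simp only: mult.assoc)
  qed
  finally show ?thesis .
qed

text \<open>Sum \<open>w2_le\<close> over the sites; the part with \<open>al\<close> alone is
  bounded by \<open>S\<close>, whose mean is known.\<close>

lemma E_P_le_quartic: "E P \<le> 4 / 3 * (1 / \<beta> + quartic)"
proof -
  have "E P \<le> E (\<lambda>y. 4 / 3 * (S y * (1 / (N * \<beta>)) + (\<Sum>k<N. (w k y)\<^sup>2 * al k y)))"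
  proof (rule E_mono)
    fix y assume y: "y \<in> conf"
    have "P y \<le> 4 / 3 * ((\<Sum>k<N. al k y) + (\<Sum>k<N. (w k y)\<^sup>2 * al k y))"
      unfolding P_def sum.distrib[symmetric] sum_distrib_left by (intro sum_mono w2_le y) auto
    also have "(\<Sum>k<N. al k y) \<le> S y * (1 / (N * \<beta>))"
      using sum_al_le_S[OF y] N beta by (simp add: field_simps)
    finally show "P y \<le> 4 / 3 * (S y * (1 / (N * \<beta>)) + (\<Sum>k<N. (w k y)\<^sup>2 * al k y))"
      by simp
  qed (auto intro!: adms)
  also have "\<dots> = 4 / 3 * (E (\<lambda>y. 1 / (N * \<beta>) * S y) + quartic)"
    unfolding E_cmult quartic_def
    by (subst E_add) (auto intro!: adms simp: E_cmult[of "1 / (N * \<beta>)" S, simplified])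
  also have "E (\<lambda>y. 1 / (N * \<beta>) * S y) = 1 / (N * \<beta>) * (real N - 1)"
    by (simp only: E_cmult E_S)
  also have "4 / 3 * (1 / (N * \<beta>) * (real N - 1) + quartic) \<le> 4 / 3 * (1 / \<beta> + quartic)"
    using N beta by (simp add: field_simps)
  finally show ?thesis .
qed

context
  assumes large: "16 \<le> real N * \<beta>"
begin

text \<open>The two preceding bounds are played against each other. The threshold 16 makes
  \<open>quartic\<close> at most 3/8 E P, and 4/3 * 3/8 = 1/2 lets half of E P be absorbed.\<close>

lemma E_P_le: "E P \<le> 3 / \<beta>"
proof -
  have quartic: "0 \<le> quartic"
    unfolding quartic_def by (intro E_nonneg sum_nonneg) (auto intro!: mult_nonneg_nonneg al_nonneg)
  have "16 * quartic \<le> real N * \<beta> * quartic"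
    using large quartic by (rule mult_right_mono)
  also note quartic_le
  finally have "quartic \<le> 3 / 8 * E P" by simp
  then have "4 / 3 * (1 / \<beta> + quartic) \<le> 4 / 3 * (1 / \<beta> + 3 / 8 * E P)" by simp
  with E_P_le_quartic have "E P \<le> 4 / 3 * (1 / \<beta> + 3 / 8 * E P)" by (rule order_trans)
  then have "E P \<le> 8 / 3 * (1 / \<beta>)" by simp
  also have "\<dots> \<le> 3 / \<beta>" using beta by (simp add: field_simps)
  finally show ?thesis .
qed

lemma quartic_bound: "quartic \<le> 18 / (\<beta>\<^sup>2 * N)"
proof -
  have "real N * \<beta> * quartic \<le> 18 / \<beta>"
    using quartic_le E_P_le by simp
  then show ?thesis
    using N beta by (simp add: field_simps power2_eq_square)
qed

end

text \<open>By rotation invariance all sites have the same expectation, hence each equals the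
  average. This turns bounds on sums into bounds per site, gaining a factor 1/N.\<close>

lemma E_site:
  assumes adm: "\<And>k. k < N \<Longrightarrow> adm (\<phi> k)"
    and turn: "\<And>k y. k < N \<Longrightarrow> \<phi> k (turn N y) = \<phi> (nx k) y"
    and k: "k < N"
  shows "E (\<phi> k) = E (\<lambda>y. \<Sum>j<N. \<phi> j y) / N"
proof -
  have e0: "E (\<phi> i) = E (\<phi> 0)" if "i < N" for i
    using that
  proof (induction i)
    case (Suc i)
    have "E (\<phi> i) = E (\<lambda>y. \<phi> i (turn N y))"
      using Suc.prems adm by (intro E_turn[symmetric] adm_measurable) auto
    also have "(\<lambda>y. \<phi> i (turn N y)) = \<phi> (Suc i)"
      using Suc.prems turn[of i] by (simp add: nx_eq)
    finally show ?case using Suc by simp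
  qed simp
  have "E (\<lambda>y. \<Sum>j<N. \<phi> j y) = (\<Sum>j<N. E (\<phi> j))"
    by (intro E_sum adm) auto
  also have "\<dots> = (\<Sum>j<N. E (\<phi> 0))"
    by (rule sum.cong[OF refl], rule e0) simp
  finally show ?thesis
    unfolding e0[OF k] using N by simp
qed

lemma w_turn: "k < N \<Longrightarrow> w k (turn N y) = w (nx k) y"
  by (simp add: w_def t_turn)

lemma al_turn: "k < N \<Longrightarrow> al k (turn N y) = al (nx k) y"
  by (simp add: al_def t_turn w_turn)

lemma P_turn: "P (turn N y) = P y"
proof -
  have "P (turn N y) = (\<Sum>k<N. w (nx k) y * w (nx k) y)"
    unfolding P_def by (rule sum.cong) (auto simp: w_turn)
  then show ?thesis
    unfolding P_def using sum_nx[of "\<lambda>k. w k y * w k y"] by simp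
qed

lemma E_w: "k < N \<Longrightarrow> E (w k) = 0"
  using E_site[of w k] by (simp add: adm_w w_turn sum_w E_const)

text \<open>Rotation moves the pair one site at a time; under k + d < N it never wraps
  around.\<close>

lemma E_w_shift: "k + d < N \<Longrightarrow> E (\<lambda>y. w k y * w (k + d) y) = E (\<lambda>y. w 0 y * w d y)"
proof (induction k)
  case (Suc k)
  have "E (\<lambda>y. w k y * w (k + d) y) = E (\<lambda>y. w k (turn N y) * w (k + d) (turn N y))"
    by (rule E_turn[symmetric]) (use Suc.prems in \<open>auto intro!: adm_measurable adms\<close>)
  also have "\<dots> = E (\<lambda>y. w (Suc k) y * w (Suc k + d) y)"
    using Suc.prems by (simp add: w_turn nx_eq)
  finally show ?case using Suc by simp
qed simp

text \<open>The common bound, of order N^(-3/2), for the third order expectations that arise from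
  the drift remainders (\<open>E_abs_w_al\<close>).\<close>

definition eta :: real where "eta = (9 / \<beta> + 21 / \<beta>\<^sup>2) / (real N * sqrt N)"

context
  assumes large: "16 \<le> real N * \<beta>"
begin

lemma E_w2: assumes "k < N" shows "E (\<lambda>y. w k y * w k y) \<le> 3 / \<beta> / N"
proof -
  have "E (\<lambda>y. w k y * w k y) = E (\<lambda>y. \<Sum>j<N. w j y * w j y) / N"
    by (rule E_site[OF _ _ assms]) (auto intro!: adms simp: w_turn)
  then show ?thesis
    using E_P_le[OF large] by (simp only: P_def[symmetric] divide_right_mono of_nat_0_le_iff)
qed

lemma E_w2_al_same: assumes "k < N" shows "E (\<lambda>y. (w k y)\<^sup>2 * al k y) \<le> 18 / (\<beta>\<^sup>2 * N) / N"
proof -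
  have "E (\<lambda>y. (w k y)\<^sup>2 * al k y) = quartic / N"
    unfolding quartic_def by (rule E_site[OF _ _ assms]) (auto intro!: adms simp: w_turn al_turn)
  then show ?thesis
    using quartic_bound[OF large] by (simp only: divide_right_mono of_nat_0_le_iff)
qed

text \<open>For different sites, w_k^2 is enlarged to the rotation invariant \<open>P\<close>; then
  \<open>al\<close> is averaged over i and bounded by \<open>S\<close>, so \<open>E_P_S\<close>
  applies. The resulting order 1/N suffices, because it is used with a further factor 1 / sqrt
  N.\<close>

lemma E_w2_al: assumes "k < N" "i < N" shows "E (\<lambda>y. w k y * w k y * al i y) \<le> 6 / (\<beta>\<^sup>2 * N)"
proof -
  have "E (\<lambda>y. w k y * w k y * al i y) \<le> E (\<lambda>y. P y * al i y)"
  proof (rule E_mono)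
    fix y assume y: "y \<in> conf"
    have "w k y * w k y \<le> P y"
      unfolding P_def using assms by (intro member_le_sum[of k "{..<N}" "\<lambda>k. w k y * w k y"]) auto
    then show "w k y * w k y * al i y \<le> P y * al i y"
      using al_nonneg[OF y assms(2)] by (rule mult_right_mono)
  qed (use assms in \<open>auto intro!: adms\<close>)
  also have "\<dots> = E (\<lambda>y. \<Sum>j<N. P y * al j y) / N"
    by (rule E_site[OF _ _ assms(2)]) (auto intro!: adms simp: P_turn al_turn)
  also have "\<dots> \<le> E (\<lambda>y. 1 / (N * \<beta>) * (P y * S y)) / N"
  proof (intro divide_right_mono E_mono)
    fix y assume y: "y \<in> conf"
    have "(\<Sum>k<N. al k y) \<le> 1 / (N * \<beta>) * S y"
      using sum_al_le_S[OF y] N beta by (simp add: field_simps)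
    then have "P y * (\<Sum>k<N. al k y) \<le> P y * (1 / (N * \<beta>) * S y)"
      using P_nonneg by (rule mult_left_mono)
    then show "(\<Sum>j<N. P y * al j y) \<le> 1 / (N * \<beta>) * (P y * S y)"
      by (simp add: sum_distrib_left mult_ac)
  qed (auto intro!: adms)
  also have "\<dots> = (1 / (N * \<beta>) * ((real N + 1) * E P)) / N"
    by (simp only: E_cmult E_P_S)
  also have "\<dots> \<le> (1 / (N * \<beta>) * ((real N + real N) * (3 / \<beta>))) / N"
    using N beta E_P_le[OF large] E_P_nonneg by (intro divide_right_mono mult_left_mono mult_mono) auto
  also have "\<dots> = 6 / (\<beta>\<^sup>2 * N)"
    using N beta by (simp add: field_simps power2_eq_square)
  finally show ?thesis .
qed

text \<open>Weighted Young inequality for |w_k| and w_i^2, carried out with the factor \<theta> of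
  \<open>al i\<close> left outside. In one term \<theta> is bounded by 6 + 4 \<open>al i\<close>; in
  the other it recombines with w_i^2 into \<open>al i\<close>.\<close>

lemma E_abs_w_al: assumes k: "k < N" and i: "i < N" shows "E (\<lambda>y. \<bar>w k y\<bar> * al i y) \<le> eta"
proof -
  \<comment> \<open>This weight balances the bounds of order 1/N in the first term against the order
    1/N^2 in the second.\<close>
  define r where "r = sqrt N"
  have r: "0 < r" "r * r = N" using N by (auto simp: r_def)
  have "E (\<lambda>y. \<bar>w k y\<bar> * al i y) \<le>
      E (\<lambda>y. 1 / (2 * r) * (6 * (w k y * w k y) + 4 * (w k y * w k y * al i y)) + r / 2 * ((w i y)\<^sup>2 * al i y))"
  proof (rule E_mono)
    fix y assume y: "y \<in> conf"
    define \<theta> where "\<theta> = (t i y + 1) / (t i y)\<^sup>2"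
    have th: "0 \<le> \<theta>" "\<theta> \<le> 6 + 4 * al i y" "al i y = (w i y)\<^sup>2 * \<theta>"
      using t_pos[OF y i] linear_over_square_le[OF t_pos[OF y i]] by (simp_all add: \<theta>_def al_def w_def)
    define u v where "u = \<bar>w k y\<bar>" and "v = (w i y)\<^sup>2"
    have "u * v \<le> 1 / (2 * r) * u\<^sup>2 + r / 2 * v\<^sup>2"
    proof -
      have "0 \<le> (u - r * v)\<^sup>2 / (2 * r)" using r by simp
      also have "\<dots> = 1 / (2 * r) * u\<^sup>2 + r / 2 * v\<^sup>2 - u * v"
        using r(1) by (simp add: power2_eq_square field_simps)
      finally show ?thesis by simp
    qed
    then have "u * v * \<theta> \<le> (1 / (2 * r) * u\<^sup>2 + r / 2 * v\<^sup>2) * \<theta>"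
      using th by (intro mult_right_mono)
    also have "\<dots> = 1 / (2 * r) * (u\<^sup>2 * \<theta>) + r / 2 * (v * (v * \<theta>))"
      by (simp add: power2_eq_square algebra_simps)
    also have "\<dots> \<le> 1 / (2 * r) * (u\<^sup>2 * (6 + 4 * al i y)) + r / 2 * (v * (v * \<theta>))"
      using th r by (intro add_right_mono mult_left_mono) auto
    finally show "\<bar>w k y\<bar> * al i y \<le>
      1 / (2 * r) * (6 * (w k y * w k y) + 4 * (w k y * w k y * al i y)) + r / 2 * ((w i y)\<^sup>2 * al i y)"
      unfolding u_def v_def th(3)[symmetric] mult.assoc[of "\<bar>w k y\<bar>"]
      by (simp add: power2_eq_square algebra_simps)
  qed (use k i in \<open>auto intro!: adms\<close>)
  also have "\<dots> = 1 / (2 * r) * (6 * E (\<lambda>y. w k y * w k y) + 4 * E (\<lambda>y. w k y * w k y * al i y)) +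
      r / 2 * E (\<lambda>y. (w i y)\<^sup>2 * al i y)"
  proof -
    have "E (\<lambda>y. 6 * (w k y * w k y) + 4 * (w k y * w k y * al i y)) =
        6 * E (\<lambda>y. w k y * w k y) + 4 * E (\<lambda>y. w k y * w k y * al i y)"
      by (subst E_add) (use k i in \<open>auto intro!: adms simp: E_cmult\<close>)
    then show ?thesis
      by (subst E_add) (use k i in \<open>auto intro!: adms simp only: E_cmult\<close>)
  qed
  also have "\<dots> \<le> 1 / (2 * r) * (6 * (3 / \<beta> / N) + 4 * (6 / (\<beta>\<^sup>2 * N))) + r / 2 * (18 / (\<beta>\<^sup>2 * N) / N)"
    using E_w2[OF k] E_w2_al[OF k i] E_w2_al_same[OF i] r
    by (intro add_mono mult_left_mono) auto
  also have "\<dots> = eta"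
    unfolding eta_def r_def[symmetric] r(2)[symmetric] using r(1) beta
    by (simp add: field_simps power2_eq_square)
  finally show ?thesis .
qed

end

end

section \<open>The covariance of the gaps\<close>

context cyclic_gas_normalizable
begin

text \<open>The Hessian of \<open>H\<close> at t = 1, as a bilinear form in v and \<open>w\<close>,
  divided by N.\<close>

definition quad :: "(nat \<Rightarrow> real) \<Rightarrow> (nat \<Rightarrow> real) \<Rightarrow> real" where
  "quad v y = (\<Sum>k<N. 2 * \<beta> * (v k * w k y) + \<gamma> / 4 * ((v k + v (nx k)) * (w k y + w (nx k) y)))"

text \<open>Remainder of the drift tested against \<open>v\<close>; for \<open>v = 1\<close> it is \<open>R\<close>.\<close>

definition err :: "(nat \<Rightarrow> real) \<Rightarrow> (nat \<Rightarrow> real) \<Rightarrow> real" where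
  "err v y = (\<Sum>k<N. \<beta> * (v k * rho k y) + \<gamma> * ((v k + v (nx k)) * sig k y))"

lemma adm_quad: "adm (quad v)"
  unfolding quad_def[abs_def] by (intro adms nx_less) (auto simp: nx_less)

lemma adm_err: "adm (err v)"
  unfolding err_def[abs_def] by (intro adms) auto

lemma sum_D_split: assumes "y \<in> conf"
  shows "(\<Sum>i<N. v i * D i y) = real N * (quad v y - err v y)"
proof -
  have "(\<Sum>k<N. \<beta> * (v k * av k y) + \<gamma> * ((v k + v (nx k)) * bv k y)) = quad v y - err v y"
    unfolding quad_def err_def sum_subtractf[symmetric]
    using assms by (intro sum.cong) (auto simp: av_rho bv_sig algebra_simps)
  then show ?thesis by (simp add: sum_D)
qed

text \<open>The identities of \<open>ibp\<close> for f = w_d at all sites i, weighted by v_i and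
  summed. A vector v that makes \<open>quad v\<close> a multiple of w_0 turns this into a formula
  for the covariance of w_0 and w_d.\<close>

lemma linear_response:
  assumes d: "d < N"
  shows "v d - real N * (E (\<lambda>y. w d y * quad v y) - E (\<lambda>y. w d y * err v y)) =
    (1 / N + E (\<lambda>y. w d y * R y)) * (\<Sum>i<N. v i)"
proof -
  have 1: "of_bool (i = d) - E (\<lambda>y. w d y * D i y) = 1 / N + E (\<lambda>y. w d y * R y)" if i: "i < N" for i
    using ibp[OF has_grad_w[OF d] w_bound[OF _ d] adm_w[OF d] adm_const i] d
    by (simp add: E_const sum_of_bool[OF d, of "\<lambda>_. 1", simplified] eq_commute[of d])
  have "(1 / N + E (\<lambda>y. w d y * R y)) * (\<Sum>i<N. v i) =
      (\<Sum>i<N. v i * (of_bool (i = d) - E (\<lambda>y. w d y * D i y)))"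
    unfolding sum_distrib_left using 1 by (intro sum.cong) auto
  also have "\<dots> = (\<Sum>i<N. v i * of_bool (i = d)) - (\<Sum>i<N. E (\<lambda>y. v i * (w d y * D i y)))"
    by (simp only: right_diff_distrib sum_subtractf E_cmult)
  also have "(\<Sum>i<N. E (\<lambda>y. v i * (w d y * D i y))) = E (\<lambda>y. \<Sum>i<N. v i * (w d y * D i y))"
    by (rule E_sum[symmetric]) (use d in \<open>auto intro!: adms\<close>)
  also have "\<dots> = E (\<lambda>y. real N * (w d y * quad v y - w d y * err v y))"
  proof (rule E_cong)
    fix y assume y: "y \<in> conf"
    have "(\<Sum>i<N. v i * (w d y * D i y)) = w d y * (\<Sum>i<N. v i * D i y)"
      unfolding sum_distrib_left by (intro sum.cong) auto
    then show "(\<Sum>i<N. v i * (w d y * D i y)) = real N * (w d y * quad v y - w d y * err v y)"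
      by (simp add: sum_D_split[OF y] algebra_simps)
  qed
  also have "\<dots> = real N * (E (\<lambda>y. w d y * quad v y) - E (\<lambda>y. w d y * err v y))"
    unfolding E_cmult by (subst E_diff) (use d in \<open>auto intro!: adms adm_quad adm_err\<close>)
  finally show ?thesis
    by (simp only: sum_of_bool[OF d])
qed

text \<open>Solves the linearised equation exactly on the cycle, also for \<open>\<delta> = 0\<close>.\<close>

definition green :: "nat \<Rightarrow> real" where
  "green i = (- decay \<beta> \<gamma>) ^ i + (- decay \<beta> \<gamma>) ^ (N - i)"

text \<open>Collect the coefficient of each w_k. Away from site 0 it is a combination of powers of q
  times the characteristic polynomial, which vanishes by \<open>decay_char\<close>. Only site 0,
  where the two geometric branches meet, contributes.\<close>

lemma quad_green:
  "quad green y = (1 - (- decay \<beta> \<gamma>) ^ N) * (2 * \<beta> + \<gamma> * (1 - decay \<beta> \<gamma>) / 2) * w 0 y"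
proof -
  define q where "q = - decay \<beta> \<gamma>"
  have ch: "\<gamma> / 4 * (1 + q\<^sup>2) + (2 * \<beta> + \<gamma> / 2) * q = 0"
    using decay_char[OF beta gamma(1)] by (simp add: q_def)
  obtain n where n: "N = Suc n" using N_pos gr0_implies_Suc by blast
  have V: "green i = q ^ i + q ^ (N - i)" for i by (simp add: green_def q_def)
  have split: "(\<Sum>k<N. g k) = g 0 + (\<Sum>k<n. g (Suc k))" for g :: "nat \<Rightarrow> real"
    unfolding n by (rule sum.lessThan_Suc_shift)
  have "N - 1 = n" using n by simp
  with nx_eq(2) have nxn: "nx n = 0" by simp
  have A: "(\<Sum>k<N. green k * w (nx k) y) = (\<Sum>k<n. green k * w (Suc k) y) + green n * w 0 y"
  proof -
    have "(\<Sum>k<N. g k) = (\<Sum>k<n. g k) + g n" for g :: "nat \<Rightarrow> real"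
      unfolding n by simp
    moreover have "nx k = Suc k" if "k < n" for k
    proof (rule nx_eq)
      show "Suc k < N" unfolding n using that by simp
    qed
    ultimately show ?thesis by (simp add: nxn)
  qed
  \<comment> \<open>\<open>green N\<close> = \<open>green 0\<close>, so the cyclic successor may be
    replaced by \<open>Suc\<close> also at the last site.\<close>
  have nxV: "green (nx k) = green (Suc k)" if "k < N" for k
  proof (cases "Suc k < N")
    case False
    then have "k = n" "Suc k = N" using that n by simp_all
    then have "nx k = 0" "Suc k = N" using nxn by simp_all
    then show ?thesis by (simp add: V)
  qed (simp add: nx_eq)
  have B: "(\<Sum>k<N. green (nx k) * w k y) = green 1 * w 0 y + (\<Sum>k<n. green (Suc (Suc k)) * w (Suc k) y)"
    using split[of "\<lambda>k. green (Suc k) * w k y"] nxV by simp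
  have "quad green y = 2 * \<beta> * (\<Sum>k<N. green k * w k y) + \<gamma> / 4 * ((\<Sum>k<N. green k * w k y) +
      (\<Sum>k<N. green (nx k) * w (nx k) y) + (\<Sum>k<N. green k * w (nx k) y) + (\<Sum>k<N. green (nx k) * w k y))"
    unfolding quad_def sum.distrib[symmetric] sum_distrib_left
    by (rule sum.cong) (auto simp: algebra_simps)
  also have "(\<Sum>k<N. green (nx k) * w (nx k) y) = (\<Sum>k<N. green k * w k y)"
    by (rule sum_nx)
  finally have "quad green y = (2 * \<beta> + \<gamma> / 2) * (green 0 * w 0 y + (\<Sum>k<n. green (Suc k) * w (Suc k) y)) +
      \<gamma> / 4 * ((\<Sum>k<n. green k * w (Suc k) y) + green n * w 0 y + green 1 * w 0 y +
        (\<Sum>k<n. green (Suc (Suc k)) * w (Suc k) y))"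
    unfolding A B split[of "\<lambda>k. green k * w k y"] by (simp add: algebra_simps)
  also have "\<dots> = ((2 * \<beta> + \<gamma> / 2) * green 0 + \<gamma> / 4 * (green n + green 1)) * w 0 y +
      (\<Sum>k<n. ((2 * \<beta> + \<gamma> / 2) * green (Suc k) + \<gamma> / 4 * (green k + green (Suc (Suc k)))) * w (Suc k) y)"
    by (simp add: algebra_simps sum.distrib sum_distrib_left)
  also have "(\<Sum>k<n. ((2 * \<beta> + \<gamma> / 2) * green (Suc k) + \<gamma> / 4 * (green k + green (Suc (Suc k)))) * w (Suc k) y) = 0"
  proof (rule sum.neutral, rule ballI)
    fix k assume "k \<in> {..<n}"
    then obtain e where e: "n = Suc k + e" using less_imp_Suc_add by fastforce
    have "(2 * \<beta> + \<gamma> / 2) * green (Suc k) + \<gamma> / 4 * (green k + green (Suc (Suc k))) =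
        (q ^ k + q ^ e) * (\<gamma> / 4 * (1 + q\<^sup>2) + (2 * \<beta> + \<gamma> / 2) * q)"
      unfolding V by (simp add: n e power2_eq_square algebra_simps add_divide_distrib)
    then show "((2 * \<beta> + \<gamma> / 2) * green (Suc k) + \<gamma> / 4 * (green k + green (Suc (Suc k)))) * w (Suc k) y = 0"
      using ch by simp
  qed
  \<comment> \<open>Splitting off a multiple of the characteristic polynomial exposes the factor 1 -
    q^N.\<close>
  also have "(2 * \<beta> + \<gamma> / 2) * green 0 + \<gamma> / 4 * (green n + green 1) =
      (1 - q ^ N) * (2 * \<beta> + \<gamma> / 2 + \<gamma> / 2 * q) +
      2 * q ^ n * (\<gamma> / 4 * (1 + q\<^sup>2) + (2 * \<beta> + \<gamma> / 2) * q)"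
    unfolding V by (simp add: n power2_eq_square algebra_simps add_divide_distrib diff_divide_distrib)
  also have "2 * \<beta> + \<gamma> / 2 + \<gamma> / 2 * q = 2 * \<beta> + \<gamma> * (1 - decay \<beta> \<gamma>) / 2"
    by (simp add: q_def algebra_simps diff_divide_distrib)
  finally show ?thesis
    unfolding ch by (simp add: q_def)
qed

text \<open>Two geometric series of ratio at most 1/4, one read backwards. That the bound does not
  depend on N keeps the error of \<open>covariance_w\<close> at order N \<open>eta\<close>.\<close>

lemma sum_green: "(\<Sum>k<N. \<bar>green k\<bar>) \<le> 4"
proof -
  define \<delta> where "\<delta> = decay \<beta> \<gamma>"
  have d: "0 \<le> \<delta>" "\<delta> \<le> 1 / 4"
    using decay_bounds[OF beta gamma] by (auto simp: \<delta>_def)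
  have g: "(\<Sum>k<n. \<delta> ^ k) \<le> 2" for n
  proof -
    have "(1 - \<delta>) * (\<Sum>k<n. \<delta> ^ k) = 1 - \<delta> ^ n"
      by (rule one_diff_power_eq[symmetric])
    also have "\<dots> \<le> 1" using d by simp
    finally have "(1 - \<delta>) * (\<Sum>k<n. \<delta> ^ k) \<le> 1" .
    moreover have "1 / 2 * (\<Sum>k<n. \<delta> ^ k) \<le> (1 - \<delta>) * (\<Sum>k<n. \<delta> ^ k)"
      using d by (intro mult_right_mono sum_nonneg) auto
    ultimately show ?thesis by linarith
  qed
  have "(\<Sum>k<N. \<bar>green k\<bar>) \<le> (\<Sum>k<N. \<delta> ^ k + \<delta> ^ (N - Suc k))"
  proof (rule sum_mono)
    fix k assume "k \<in> {..<N}"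
    have "\<bar>green k\<bar> \<le> \<delta> ^ k + \<delta> ^ (N - k)"
      unfolding green_def \<delta>_def[symmetric]
      by (rule order_trans[OF abs_triangle_ineq]) (use d in \<open>simp add: power_abs\<close>)
    \<comment> \<open>The exponent is lowered by one so that reversing the order of summation gives
      the same series.\<close>
    also have "\<delta> ^ (N - k) \<le> \<delta> ^ (N - Suc k)"
      using d by (intro power_decreasing) auto
    finally show "\<bar>green k\<bar> \<le> \<delta> ^ k + \<delta> ^ (N - Suc k)" by simp
  qed
  also have "\<dots> = (\<Sum>k<N. \<delta> ^ k) + (\<Sum>k<N. \<delta> ^ k)"
    unfolding sum.distrib sum.nat_diff_reindex by simp
  finally show ?thesis using g[of N] by linarith
qed

section \<open>Error estimate and asymptotics of the covariance\<close>

context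
  assumes large: "16 \<le> real N * \<beta>"
begin

lemma eta_nonneg: "0 \<le> eta"
  unfolding eta_def using beta by simp

text \<open>Both kinds of remainder are bounded by \<open>al\<close> at one or two sites, so
  \<open>E_abs_w_al\<close> applies to every term. The weights add up to 2 \<beta> + \<gamma>, which
  is at most 3 \<beta>.\<close>

lemma E_err: assumes d: "d < N"
  shows "\<bar>E (\<lambda>y. w d y * err v y)\<bar> \<le> 3 * \<beta> * eta * (\<Sum>k<N. \<bar>v k\<bar>)"
proof -
  let ?f = "\<lambda>k y. 2 * \<beta> * \<bar>v k\<bar> * (\<bar>w d y\<bar> * al k y) +
      \<gamma> * (\<bar>v k\<bar> + \<bar>v (nx k)\<bar>) / 4 * (\<bar>w d y\<bar> * al k y + \<bar>w d y\<bar> * al (nx k) y)"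
  have pt: "\<bar>w d y * err v y\<bar> \<le> (\<Sum>k<N. ?f k y)" if y: "y \<in> conf" for y
  proof -
    have "\<bar>w d y * err v y\<bar> \<le> (\<Sum>k<N. \<bar>w d y\<bar> * \<bar>\<beta> * (v k * rho k y) + \<gamma> * ((v k + v (nx k)) * sig k y)\<bar>)"
      unfolding err_def abs_mult sum_distrib_left[symmetric]
      by (intro mult_left_mono sum_abs) simp
    also have "\<dots> \<le> (\<Sum>k<N. ?f k y)"
    proof (rule sum_mono)
      fix k assume "k \<in> {..<N}"
      then have k: "k < N" by simp
      have s: "sig k y \<le> (al k y + al (nx k) y) / 4"
        using sig_le_rho[OF y k] rho_le_al[OF y k] rho_le_al[OF y nx_less[of k]] by simp
      have "\<bar>\<beta> * (v k * rho k y) + \<gamma> * ((v k + v (nx k)) * sig k y)\<bar> \<le>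
          \<bar>\<beta> * (v k * rho k y)\<bar> + \<bar>\<gamma> * ((v k + v (nx k)) * sig k y)\<bar>"
        by (rule abs_triangle_ineq)
      also have "\<bar>\<beta> * (v k * rho k y)\<bar> = \<beta> * (\<bar>v k\<bar> * rho k y)"
        using beta rho_nonneg[OF y k] by (simp add: abs_mult)
      also have "\<dots> \<le> \<beta> * (\<bar>v k\<bar> * (2 * al k y))"
        using beta rho_le_al[OF y k] by (intro mult_left_mono) auto
      also have "\<bar>\<gamma> * ((v k + v (nx k)) * sig k y)\<bar> = \<gamma> * (\<bar>v k + v (nx k)\<bar> * sig k y)"
        using gamma sig_nonneg[OF y k] by (simp add: abs_mult)
      also have "\<dots> \<le> \<gamma> * ((\<bar>v k\<bar> + \<bar>v (nx k)\<bar>) * ((al k y + al (nx k) y) / 4))"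
        using gamma s sig_nonneg[OF y k] by (intro mult_left_mono mult_mono) auto
      finally have "\<bar>w d y\<bar> * \<bar>\<beta> * (v k * rho k y) + \<gamma> * ((v k + v (nx k)) * sig k y)\<bar> \<le>
         \<bar>w d y\<bar> * (\<beta> * (\<bar>v k\<bar> * (2 * al k y)) + \<gamma> * ((\<bar>v k\<bar> + \<bar>v (nx k)\<bar>) * ((al k y + al (nx k) y) / 4)))"
        by (intro mult_left_mono) auto
      then show "\<bar>w d y\<bar> * \<bar>\<beta> * (v k * rho k y) + \<gamma> * ((v k + v (nx k)) * sig k y)\<bar> \<le> ?f k y"
        by (simp add: algebra_simps add_divide_distrib)
    qed
    finally show ?thesis .
  qed
  have af: "adm (\<lambda>y. \<Sum>k<N. ?f k y)" and ae: "adm (\<lambda>y. w d y * err v y)"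
    using d nx_less by (auto intro!: adms adm_err)
  have "E (\<lambda>y. \<Sum>k<N. ?f k y) = (\<Sum>k<N. E (?f k))"
    by (rule E_sum) (use d nx_less in \<open>auto intro!: adms\<close>)
  also have "\<dots> \<le> (\<Sum>k<N. 2 * \<beta> * \<bar>v k\<bar> * eta + \<gamma> * (\<bar>v k\<bar> + \<bar>v (nx k)\<bar>) / 4 * (eta + eta))"
  proof (rule sum_mono)
    fix k assume "k \<in> {..<N}"
    then have k: "k < N" by simp
    have "E (?f k) = 2 * \<beta> * \<bar>v k\<bar> * E (\<lambda>y. \<bar>w d y\<bar> * al k y) + \<gamma> * (\<bar>v k\<bar> + \<bar>v (nx k)\<bar>) / 4 *
        (E (\<lambda>y. \<bar>w d y\<bar> * al k y) + E (\<lambda>y. \<bar>w d y\<bar> * al (nx k) y))"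
    proof -
      have "adm (\<lambda>y. \<bar>w d y\<bar> * al k y)" "adm (\<lambda>y. \<bar>w d y\<bar> * al (nx k) y)"
        using d k nx_less by (auto intro!: adms)
      then show ?thesis
        by (simp only: E_add E_cmult adm_add adm_mult adm_const)
    qed
    also have "\<dots> \<le> 2 * \<beta> * \<bar>v k\<bar> * eta + \<gamma> * (\<bar>v k\<bar> + \<bar>v (nx k)\<bar>) / 4 * (eta + eta)"
      using E_abs_w_al[OF large d k] E_abs_w_al[OF large d nx_less[of k]] beta gamma
      by (intro add_mono mult_left_mono) auto
    finally show "E (?f k) \<le> 2 * \<beta> * \<bar>v k\<bar> * eta + \<gamma> * (\<bar>v k\<bar> + \<bar>v (nx k)\<bar>) / 4 * (eta + eta)" .
  qed
  also have "\<dots> = (2 * \<beta> + \<gamma> / 2) * eta * (\<Sum>k<N. \<bar>v k\<bar>) + \<gamma> / 2 * eta * (\<Sum>k<N. \<bar>v (nx k)\<bar>)"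
    unfolding sum_distrib_left sum.distrib[symmetric] by (rule sum.cong) (auto simp: algebra_simps)
  also have "\<dots> = (2 * \<beta> + \<gamma>) * eta * (\<Sum>k<N. \<bar>v k\<bar>)"
    unfolding sum_nx[of "\<lambda>k. \<bar>v k\<bar>"] by (simp add: algebra_simps)
  also have "\<dots> \<le> 3 * \<beta> * eta * (\<Sum>k<N. \<bar>v k\<bar>)"
    using gamma eta_nonneg by (intro mult_right_mono sum_nonneg) auto
  finally have *: "E (\<lambda>y. \<Sum>k<N. ?f k y) \<le> 3 * \<beta> * eta * (\<Sum>k<N. \<bar>v k\<bar>)" .
  have "E (\<lambda>y. w d y * err v y) \<le> E (\<lambda>y. \<Sum>k<N. ?f k y)"
    using pt by (intro E_mono ae af) (auto simp: abs_le_iff)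
  moreover have "E (\<lambda>y. - 1 * (w d y * err v y)) \<le> E (\<lambda>y. \<Sum>k<N. ?f k y)"
    using pt by (intro E_mono adm_mult[OF adm_const ae] af) (auto simp: abs_le_iff)
  ultimately show ?thesis
    using * unfolding E_cmult by (simp add: abs_le_iff)
qed

text \<open>\<open>linear_response\<close> with v = \<open>green\<close> gives (1 - q^N) x =
  \<open>green d\<close> up to errors of order N \<open>eta\<close> + 1/N. What remains is to
  discard the powers of q with exponent at least N/2 and to divide by 1 - q^N.\<close>

lemma covariance_w:
  assumes d: "d < N"
  defines "\<delta> \<equiv> decay \<beta> \<gamma>"
  shows "\<bar>(2 * \<beta> + \<gamma> * (1 - \<delta>) / 2) * (real N * E (\<lambda>y. w 0 y * w d y)) - (- \<delta>) ^ min d (N - d)\<bar>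
    \<le> (444 + 1008 / \<beta>) / sqrt N"
proof -
  define q where "q = - \<delta>"
  define \<kappa> where "\<kappa> = 2 * \<beta> + \<gamma> * (1 - \<delta>) / 2"
  define e where "e = min d (N - d)"
  define x where "x = \<kappa> * (real N * E (\<lambda>y. w 0 y * w d y))"
  have q: "\<bar>q\<bar> \<le> 1 / 4"
    using decay_bounds[OF beta gamma] by (simp add: q_def \<delta>_def)
  \<comment> \<open>Since |q| is at most 1/4, a power with exponent at least N/2 is at most
    2^(-N).\<close>
  have half: "\<bar>q ^ m\<bar> \<le> 1 / N" if "N \<le> 2 * m" for m
  proof -
    have "\<bar>q ^ m\<bar> \<le> (1 / 4) ^ m"
      unfolding power_abs using q by (intro power_mono) auto
    also have "(1 / 4 :: real) ^ m = (1 / 2) ^ (2 * m)"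
      by (simp add: power_mult power2_eq_square)
    also have "\<dots> \<le> (1 / 2) ^ N"
      using that by (intro power_decreasing) auto
    also have "\<dots> \<le> 1 / N"
      using of_nat_less_two_power[of N, where 'a = real] N
      by (simp add: power_one_over field_simps less_imp_le)
    finally show ?thesis .
  qed
  have sq: "1 / N \<le> 1 / sqrt N"
    using N by (intro divide_left_mono) (auto intro!: real_le_lsqrt simp: power2_eq_square)
  have qN: "1 / 2 \<le> 1 - q ^ N"
  proof -
    have "1 / real N \<le> 1 / 2" using N by simp
    then show ?thesis using half[of N] abs_ge_self[of "q ^ N"] by linarith
  qed
  have eq: "(1 - q ^ N) * x - green d = real N * E (\<lambda>y. w d y * err green y) -
      (1 / N + E (\<lambda>y. w d y * err (\<lambda>_. 1) y)) * (\<Sum>i<N. green i)"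
  proof -
    have "E (\<lambda>y. w d y * quad green y) = E (\<lambda>y. (1 - q ^ N) * \<kappa> * (w 0 y * w d y))"
      by (rule E_cong) (simp add: quad_green q_def \<kappa>_def \<delta>_def mult_ac)
    also have "\<dots> = (1 - q ^ N) * \<kappa> * E (\<lambda>y. w 0 y * w d y)"
      by (rule E_cmult)
    finally have 1: "real N * E (\<lambda>y. w d y * quad green y) = (1 - q ^ N) * x"
      by (simp add: x_def)
    \<comment> \<open>Since \<open>R\<close> is the remainder for v = 1, the same estimate
      \<open>E_err\<close> covers it, with the sum of |v_k| equal to N.\<close>
    have 2: "E (\<lambda>y. w d y * R y) = E (\<lambda>y. w d y * err (\<lambda>_. 1) y)"
      by (rule E_cong) (simp add: R_eq err_def mult_ac)
    show ?thesis
      using linear_response[OF d, of green] 1 2 by (simp add: right_diff_distrib)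
  qed
  have G: "\<bar>\<Sum>i<N. green i\<bar> \<le> 4"
    using sum_green sum_abs[of green "{..<N}"] by linarith
  have "\<bar>(1 - q ^ N) * x - green d\<bar> \<le> real N * (3 * \<beta> * eta * 4) + (1 / N + 3 * \<beta> * eta * N) * 4"
  proof -
    have a: "\<bar>real N * E (\<lambda>y. w d y * err green y)\<bar> \<le> real N * (3 * \<beta> * eta * 4)"
    proof -
      have "3 * \<beta> * eta * (\<Sum>k<N. \<bar>green k\<bar>) \<le> 3 * \<beta> * eta * 4"
        using sum_green beta eta_nonneg by (intro mult_left_mono) auto
      with E_err[OF d, of green] have "\<bar>E (\<lambda>y. w d y * err green y)\<bar> \<le> 3 * \<beta> * eta * 4"
        by (rule order_trans)
      then show ?thesis
        unfolding abs_mult abs_of_nat by (rule mult_left_mono) simp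
    qed
    have b: "\<bar>1 / N + E (\<lambda>y. w d y * err (\<lambda>_. 1) y)\<bar> \<le> 1 / N + 3 * \<beta> * eta * N"
      using E_err[OF d, of "\<lambda>_. 1"] by (intro order_trans[OF abs_triangle_ineq] add_mono) auto
    have "\<bar>(1 / N + E (\<lambda>y. w d y * err (\<lambda>_. 1) y)) * (\<Sum>i<N. green i)\<bar> \<le> (1 / N + 3 * \<beta> * eta * N) * 4"
      unfolding abs_mult[of "1 / N + E _"] using G b by (intro mult_mono) linarith+
    with a show ?thesis
      unfolding eq by linarith
  qed
  also have "\<dots> = 24 * (\<beta> * (real N * eta)) + 4 * (1 / N)"
    by (simp add: algebra_simps)
  also have "\<beta> * (real N * eta) = (9 + 21 / \<beta>) * (1 / sqrt N)"
    unfolding eta_def using beta N by (simp add: field_simps power2_eq_square)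
  also have "24 * ((9 + 21 / \<beta>) * (1 / sqrt N)) + 4 * (1 / N) \<le> (220 + 504 / \<beta>) * (1 / sqrt N)"
    using sq by (simp add: algebra_simps)
  finally have m: "\<bar>(1 - q ^ N) * x - green d\<bar> \<le> (220 + 504 / \<beta>) * (1 / sqrt N)" .
  \<comment> \<open>\<open>green\<close> is symmetric under d -> N - d, so d may be replaced by the
    cyclic distance e; then N - e is at least N/2.\<close>
  have g: "green d = q ^ e + q ^ (N - e)"
    using d by (auto simp: green_def e_def q_def \<delta>_def min_def)
  have "(1 - q ^ N) * (x - q ^ e) = ((1 - q ^ N) * x - green d) + q ^ (N - e) + q ^ (e + N)"
    unfolding g by (simp add: algebra_simps power_add)
  moreover have "\<bar>q ^ (N - e)\<bar> \<le> 1 / sqrt N" "\<bar>q ^ (e + N)\<bar> \<le> 1 / sqrt N"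
  proof -
    have "N \<le> 2 * (N - e)" "N \<le> 2 * (e + N)"
      using d unfolding e_def min_def by auto
    then show "\<bar>q ^ (N - e)\<bar> \<le> 1 / sqrt N" "\<bar>q ^ (e + N)\<bar> \<le> 1 / sqrt N"
      by (auto intro: order_trans[OF half sq])
  qed
  ultimately have "\<bar>(1 - q ^ N) * (x - q ^ e)\<bar> \<le> (220 + 504 / \<beta>) * (1 / sqrt N) + 1 / sqrt N + 1 / sqrt N"
    using m by linarith
  also have "\<dots> = (222 + 504 / \<beta>) * (1 / sqrt N)"
    by (simp add: add_divide_distrib)
  finally have "\<bar>(1 - q ^ N) * (x - q ^ e)\<bar> \<le> (222 + 504 / \<beta>) * (1 / sqrt N)" .
  moreover have "1 / 2 * \<bar>x - q ^ e\<bar> \<le> \<bar>(1 - q ^ N) * (x - q ^ e)\<bar>"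
    unfolding abs_mult using qN by (intro mult_right_mono) auto
  ultimately have "1 / 2 * \<bar>x - q ^ e\<bar> \<le> (222 + 504 / \<beta>) * (1 / sqrt N)"
    by (rule order_trans[rotated])
  then have "\<bar>x - q ^ e\<bar> \<le> 2 * ((222 + 504 / \<beta>) * (1 / sqrt N))" by simp
  also have "\<dots> = (444 + 1008 / \<beta>) / sqrt N" by (simp add: algebra_simps add_divide_distrib)
  finally show ?thesis
    by (simp add: x_def \<kappa>_def q_def e_def)
qed

end

end

section \<open>Back to the Gibbs measure\<close>

context cyclic_gas
begin

text \<open>The extra term of \<open>energy\<close> is the pair term of the last bond, because
  \<open>s (N - 1)\<close> adds the last gap and the first one.\<close>

lemma energy_embed: "energy \<beta> \<gamma> N (embed N y) = H y"
proof -
  let ?e = "embed N y"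
  have 1: "(\<Sum>j=1..N. \<beta> / (?e j - ?e (j - 1))) = (\<Sum>k<N. \<beta> * real N / t k y)"
  proof -
    have "(\<Sum>j=1..N. \<beta> / (?e j - ?e (j - 1))) = (\<Sum>k<N. \<beta> / (?e (Suc k) - ?e k))"
      by (rule sum.reindex_bij_witness[of _ Suc "\<lambda>j. j - 1"]) auto
    also have "\<dots> = (\<Sum>k<N. \<beta> * real N / t k y)"
      using N by (intro sum.cong) (auto simp: t_def)
    finally show ?thesis .
  qed
  have t_last: "t (N - 1) y = real N * (1 - ?e (N - 1))"
    using N embed_simps(2)[of y] by (simp add: t_def)
  have s_last: "\<gamma> / (1 - ?e (N - 1) + ?e 1) = \<gamma> * real N / s (N - 1) y"
  proof -
    have "s (N - 1) y = real N * (1 - ?e (N - 1) + ?e 1)"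
      using t_last embed_simps(1)[of y] by (simp only: s_def nx_eq) (simp add: t_def algebra_simps)
    then show ?thesis using N by simp
  qed
  have 2: "(\<Sum>j=2..N. \<gamma> / (?e j - ?e (j - 2))) = (\<Sum>k<N - 1. \<gamma> * real N / s k y)"
  proof -
    have "(\<Sum>j=2..N. \<gamma> / (?e j - ?e (j - 2))) = (\<Sum>k<N - 1. \<gamma> / (?e (Suc (Suc k)) - ?e k))"
      by (rule sum.reindex_bij_witness[of _ "\<lambda>k. Suc (Suc k)" "\<lambda>j. j - 2"])
        (auto simp: numeral_2_eq_2 Suc_diff_Suc)
    also have "\<dots> = (\<Sum>k<N - 1. \<gamma> * real N / s k y)"
    proof (rule sum.cong[OF refl])
      fix k assume "k \<in> {..<N - 1}"
      then have "s k y = real N * (?e (Suc (Suc k)) - ?e k)"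
        by (simp add: s_def nx_eq t_def algebra_simps)
      then show "\<gamma> / (?e (Suc (Suc k)) - ?e k) = \<gamma> * real N / s k y"
        using N by simp
    qed
    finally show ?thesis .
  qed
  have "(\<Sum>k<N. \<gamma> * real N / s k y) = (\<Sum>k<N - 1. \<gamma> * real N / s k y) + \<gamma> * real N / s (N - 1) y"
    using sum.lessThan_Suc[of "\<lambda>k. \<gamma> * real N / s k y" "N - 1"] N by simp
  then show ?thesis
    unfolding energy_def 1 2 s_last H_def sum.distrib by simp
qed

lemma embed_configurations: assumes "y \<in> space L"
  shows "embed N y \<in> configurations N \<longleftrightarrow> y \<in> conf"
proof -
  have "embed N y \<in> extensional {..N}" by (simp add: embed_def)
  moreover have "embed N y i < embed N y (Suc i) \<longleftrightarrow> 0 < t i y" for i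
    using N by (simp add: t_def zero_less_mult_iff)
  ultimately show ?thesis
    using assms by (simp add: configurations_def conf_def embed_simps)
qed

lemma gibbs_density_embed: assumes "y \<in> space L"
  shows "gibbs_density \<beta> \<gamma> N (embed N y) = wt y / partition_function \<beta> \<gamma> N"
  by (simp add: gibbs_density_def wt_def energy_embed embed_configurations[OF assms] indicator_def)

lemma gibbs_density_nonneg: "0 \<le> gibbs_density \<beta> \<gamma> N y"
proof -
  have "0 \<le> partition_function \<beta> \<gamma> N"
    unfolding partition_function_def set_lebesgue_integral_def
    by (intro Bochner_Integration.integral_nonneg) simp
  then show ?thesis by (simp add: gibbs_density_def)
qed

text \<open>\<open>free_lebesgue\<close> is the image of \<open>L\<close> under
  \<open>embed\<close>, so the law of Y pulls back to the weight \<open>wt\<close> on the free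
  coordinates.\<close>

lemma integral_distributed:
  assumes Y: "distributed M (free_lebesgue N) Y (\<lambda>y. ennreal (gibbs_density \<beta> \<gamma> N y))"
    and g: "g \<in> borel_measurable (\<Pi>\<^sub>M i\<in>{..N}. borel)"
  shows "(LINT \<omega>|M. g (Y \<omega>)) = (LINT y|L. wt y * g (embed N y)) / partition_function \<beta> \<gamma> N"
proof -
  have sets: "sets (free_lebesgue N) = sets (\<Pi>\<^sub>M i\<in>{..N}. borel)"
    by (simp add: free_lebesgue_def)
  have g': "g \<in> borel_measurable (free_lebesgue N)"
    using g measurable_cong_sets[OF sets refl] by blast
  \<comment> \<open>Measurability of the density is part of what \<open>distributed\<close>
    provides.\<close>
  have "gibbs_density \<beta> \<gamma> N \<in> borel_measurable (free_lebesgue N)"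
    by (rule distributed_real_measurable[OF gibbs_density_nonneg Y])
  then have gd: "gibbs_density \<beta> \<gamma> N \<in> borel_measurable (\<Pi>\<^sub>M i\<in>{..N}. borel)"
    using measurable_cong_sets[OF sets refl] by blast
  have "(LINT \<omega>|M. g (Y \<omega>)) = (LINT y|free_lebesgue N. gibbs_density \<beta> \<gamma> N y * g y)"
    by (rule distributed_integral[OF Y g' gibbs_density_nonneg, symmetric])
  also have "\<dots> = (LINT y|L. gibbs_density \<beta> \<gamma> N (embed N y) * g (embed N y))"
    unfolding free_lebesgue_def L_def
    by (rule integral_distr[OF measurable_embed]) (intro borel_measurable_times gd g)
  also have "\<dots> = (LINT y|L. (wt y * g (embed N y)) / partition_function \<beta> \<gamma> N)"
    by (rule Bochner_Integration.integral_cong) (simp_all add: gibbs_density_embed)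
  finally show ?thesis by simp
qed

text \<open>Total mass 1 reads 1 = Z / \<open>partition_function\<close>. Division by 0 gives 0, so
  this equation excludes that either one vanishes and identifies the two.\<close>

lemma
  assumes M: "prob_space M"
    and Y: "distributed M (free_lebesgue N) Y (\<lambda>y. ennreal (gibbs_density \<beta> \<gamma> N y))"
  shows Z_nonzero: "Z \<noteq> 0"
    and expectation_eq: "g \<in> borel_measurable (\<Pi>\<^sub>M i\<in>{..N}. borel) \<Longrightarrow>
      (LINT \<omega>|M. g (Y \<omega>)) = E (\<lambda>y. g (embed N y))"
proof -
  interpret prob_space M by fact
  have "(LINT \<omega>|M. 1) = (LINT y|L. wt y * 1) / partition_function \<beta> \<gamma> N"
    using integral_distributed[OF Y, of "\<lambda>_. 1"] by simp
  then have 1: "1 = Z / partition_function \<beta> \<gamma> N"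
    by (simp add: Z_def prob_space)
  then show "Z \<noteq> 0" by auto
  have "partition_function \<beta> \<gamma> N = Z"
    using 1 by (metis div_by_0 eq_divide_eq mult_1 zero_neq_one)
  then show "(LINT \<omega>|M. g (Y \<omega>)) = E (\<lambda>y. g (embed N y))"
    if "g \<in> borel_measurable (\<Pi>\<^sub>M i\<in>{..N}. borel)"
    using integral_distributed[OF Y that] by (simp add: E_def)
qed

end

context cyclic_gas_normalizable
begin

text \<open>Each gap is (1 + w_k) / N with E w_k = 0; the covariance is moved to the pair (0, k - j)
  by \<open>E_w_shift\<close>.\<close>

lemma gap_moments:
  fixes Y :: "nat \<Rightarrow> 'b \<Rightarrow> nat \<Rightarrow> real"
  assumes M: "prob_space M"
    and Y: "distributed M (free_lebesgue N) (Y N) (\<lambda>y. ennreal (gibbs_density \<beta> \<gamma> N y))"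
  shows "k < N \<Longrightarrow> (LINT \<omega>|M. gap Y N k \<omega>) = 1 / real N"
    and "k < N \<Longrightarrow> j \<le> k \<Longrightarrow>
      covariance M (gap Y N j) (gap Y N k) = E (\<lambda>y. w 0 y * w (k - j) y) / (real N)\<^sup>2"
proof -
  have c: "(\<lambda>x. x i) \<in> borel_measurable (\<Pi>\<^sub>M i\<in>{..N}. (borel :: real measure))" if "i \<le> N" for i
    using that by (intro measurable_component_singleton) simp
  have g: "(\<lambda>x. x (k + 1) - x k) \<in> borel_measurable (\<Pi>\<^sub>M i\<in>{..N}. (borel :: real measure))" if "k < N" for k
    using that by (intro borel_measurable_diff c) auto
  have w: "embed N y (k + 1) - embed N y k = 1 / N * (1 + w k y)" for k y
    using N by (simp add: w_def t_def)
  show mean: "(LINT \<omega>|M. gap Y N k \<omega>) = 1 / real N" if k: "k < N" for k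
  proof -
    have "(LINT \<omega>|M. gap Y N k \<omega>) = E (\<lambda>y. 1 / N * (1 + w k y))"
      unfolding gap_def using expectation_eq[OF M Y g[OF k]] by (simp only: w)
    also have "\<dots> = 1 / N * (E (\<lambda>_. 1) + E (w k))"
      unfolding E_cmult by (subst E_add) (use k in \<open>auto intro!: adms\<close>)
    finally show ?thesis using k by (simp add: E_const E_w)
  qed
  show "covariance M (gap Y N j) (gap Y N k) = E (\<lambda>y. w 0 y * w (k - j) y) / (real N)\<^sup>2"
    if k: "k < N" and jk: "j \<le> k"
  proof -
    have j: "j < N" using jk k by simp
    have "covariance M (gap Y N j) (gap Y N k) =
        (LINT \<omega>|M. (gap Y N j \<omega> - 1 / real N) * (gap Y N k \<omega> - 1 / real N))"
      unfolding covariance_def mean[OF j] mean[OF k] ..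
    also have "\<dots> = E (\<lambda>y. (embed N y (j + 1) - embed N y j - 1 / real N) *
        (embed N y (k + 1) - embed N y k - 1 / real N))"
      unfolding gap_def
      by (rule expectation_eq[OF M Y, of "\<lambda>x. (x (j + 1) - x j - 1 / real N) * (x (k + 1) - x k - 1 / real N)"])
        (intro borel_measurable_times borel_measurable_diff[OF g] borel_measurable_const j k)
    also have "\<dots> = E (\<lambda>y. 1 / (real N)\<^sup>2 * (w j y * w k y))"
      by (rule E_cong) (simp only: w, simp add: algebra_simps power2_eq_square)
    also have "\<dots> = E (\<lambda>y. w j y * w (j + (k - j)) y) / (real N)\<^sup>2"
      unfolding E_cmult using jk by simp
    also have "E (\<lambda>y. w j y * w (j + (k - j)) y) = E (\<lambda>y. w 0 y * w (k - j) y)"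
      by (rule E_w_shift) (use jk k in simp)
    finally show ?thesis .
  qed
qed

end

theorem theorem1p2:
  fixes \<beta> \<gamma> :: real
    and M :: "nat \<Rightarrow> 'a measure"
    and Y :: "nat \<Rightarrow> 'a \<Rightarrow> nat \<Rightarrow> real"
  assumes "\<beta> > 0" and "0 \<le> \<gamma>" and "\<gamma> \<le> \<beta>"
    and "\<And>N. N > 2 \<Longrightarrow> prob_space (M N)"
    and "\<And>N. N > 2 \<Longrightarrow>
           distributed (M N) (free_lebesgue N) (Y N) (\<lambda>y. ennreal (gibbs_density \<beta> \<gamma> N y))"
  shows "(\<forall>N>2. \<forall>k<N. prob_space.expectation (M N) (gap Y N k) = 1 / real N)
    \<and> (\<exists>r. uniform_bigo r (\<lambda>N. real N powr (- 1 / 6)) \<and>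
        (\<forall>N>2. \<forall>k<N. \<forall>j\<le>k.
          covariance (M N) (gap Y N j) (gap Y N k) =
            1 / real N ^ 3 * (1 / (2 * \<beta> + \<gamma> * (1 - decay \<beta> \<gamma>) / 2)) *
            ((- decay \<beta> \<gamma>) ^ min (k - j) (N - (k - j)) + r N j k)))
    \<and> (\<exists>r. uniform_bigo (\<lambda>N j k. r N j) (\<lambda>N. real N powr (- 1 / 6)) \<and>
        (\<forall>N>2. \<forall>j<N.
          prob_space.variance (M N) (gap Y N j) =
            1 / real N ^ 3 * (1 / (2 * \<beta> + \<gamma> * (1 - decay \<beta> \<gamma>) / 2)) * (1 + r N j)))"
proof -
  define \<delta> where "\<delta> = decay \<beta> \<gamma>"
  define \<kappa> where "\<kappa> = 2 * \<beta> + \<gamma> * (1 - \<delta>) / 2"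
  have "0 \<le> \<gamma> * (1 - \<delta>)"
    using decay_bounds[OF assms(1-3)] assms(2) by (simp add: \<delta>_def)
  then have \<kappa>: "0 < \<kappa>"
    using assms(1) unfolding \<kappa>_def by linarith
  \<comment> \<open>The error is defined by solving the claimed formula for it, so that the identity
    holds for every N > 2 and only the bound remains to be shown.\<close>
  define r where "r N j k = \<kappa> * (real N ^ 3 * covariance (M N) (gap Y N j) (gap Y N k)) -
      (- \<delta>) ^ min (k - j) (N - (k - j))" for N j k
  have gas: "cyclic_gas_normalizable N \<beta> \<gamma>" if "2 < N" for N
  proof -
    interpret cyclic_gas N \<beta> \<gamma>
      using that assms by unfold_locales
    show ?thesis
      using Z_nonzero[OF assms(4)[OF that] assms(5)[OF that]] by unfold_locales
  qed
  have mean: "prob_space.expectation (M N) (gap Y N k) = 1 / real N" if "2 < N" "k < N" for N k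
    by (rule cyclic_gas_normalizable.gap_moments(1)[where Y = Y, OF gas[OF that(1)] assms(4,5)[OF that(1)] that(2)])
  have cov: "covariance (M N) (gap Y N j) (gap Y N k) =
      1 / real N ^ 3 * (1 / \<kappa>) * ((- \<delta>) ^ min (k - j) (N - (k - j)) + r N j k)" if "2 < N" for N j k
    using that \<kappa> by (simp add: r_def)
  define C where "C = 444 + 1008 / \<beta>"
  have C: "0 < C" using assms(1) by (simp add: C_def add_pos_pos)
  have bound: "\<bar>r N j k\<bar> \<le> C * \<bar>real N powr (- 1 / 6)\<bar>"
    if Nl: "2 < N" "16 / \<beta> \<le> real N" and jk: "k < N" "j \<le> k" for N j k
  proof -
    interpret cyclic_gas_normalizable N \<beta> \<gamma> by (rule gas[OF Nl(1)])
    have large: "16 \<le> real N * \<beta>"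
      using Nl(2) assms(1) by (simp add: divide_le_eq)
    have "real N ^ 3 * covariance (M N) (gap Y N j) (gap Y N k) = real N * E (\<lambda>y. w 0 y * w (k - j) y)"
      using gap_moments(2)[where Y = Y, OF assms(4,5)[OF Nl(1)] jk] Nl(1) by (simp add: power2_eq_square power3_eq_cube)
    then have "\<bar>r N j k\<bar> \<le> C / sqrt N"
      using covariance_w[OF large, of "k - j"] jk by (simp add: r_def \<kappa>_def \<delta>_def C_def)
    also have "\<dots> = C * (real N powr (- 1 / 2))"
      unfolding minus_divide_left[symmetric] powr_minus powr_half_sqrt[OF of_nat_0_le_iff] divide_inverse[of C] ..
    \<comment> \<open>The bound obtained is of order N^(-1/2), which is stronger than the rate
      claimed.\<close>
    also have "\<dots> \<le> C * (real N powr (- 1 / 6))"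
      using C Nl(1) by (intro mult_left_mono powr_mono) auto
    finally show ?thesis by simp
  qed
  \<comment> \<open>The second condition is the threshold 16 <= N \<beta> of the moment
    bounds.\<close>
  have ev: "\<forall>\<^sub>F N in sequentially. 2 < N \<and> 16 / \<beta> \<le> real N"
    by (intro eventually_conj eventually_gt_at_top eventually_compose_filterlim[OF eventually_ge_at_top filterlim_real_sequentially])
  have bigo: "uniform_bigo r (\<lambda>N. real N powr (- 1 / 6))"
    unfolding uniform_bigo_def
    by (rule exI[of _ C], rule eventually_mono[OF ev]) (use bound in blast)
  have bigo_diag: "uniform_bigo (\<lambda>N j k. r N j j) (\<lambda>N. real N powr (- 1 / 6))"
    unfolding uniform_bigo_def
    by (rule exI[of _ C], rule eventually_mono[OF ev]) (use bound in \<open>blast intro: le_less_trans\<close>)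
  have var: "prob_space.variance (M N) (gap Y N j) = 1 / real N ^ 3 * (1 / \<kappa>) * (1 + r N j j)"
    if "2 < N" for N j
    using cov[OF that, of j j] by (simp add: covariance_def power2_eq_square)
  show ?thesis
    unfolding \<delta>_def[symmetric] \<kappa>_def[symmetric]
    by (intro conjI exI[of _ r] exI[of _ "\<lambda>N j. r N j j"] allI impI bigo bigo_diag mean cov var)
qed

end
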